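(* Let $(X,f)$ be a dynamical system with an expansive $\ell$-Markov partition $\mathscr{H}=\{H_i\}$, $\lambda(H_i)<\infty$ for all $i$, whose transition matrix $P$ defines an irreducible, aperiodic, positive recurrent Markov chain. Let $\pi$ be the absolutely continuous measure on $\mathscr{L}(X)$ with density $\tau$, where $\tau(x)=\frac{\lim_{k\to\infty}p_{ii}^{(k)}}{\lambda(H_i)}$ for all $x\in\operatorname{int}(H_i)$ and all $i$. Suppose that $\mu$ is an invariant measure on $\mathscr{L}(X)$ (that is, $\mu(f^{-1}(A))=\mu(A)$ for all $A\in\mathscr{L}(X)$) and that there exists a density $\rho:X\to[0,\infty]$ such that $\mu(A)=\int_A\rho\,d\lambda$ for all $A\in\mathscr{L}(X)$. If $\mu(X)=\infty$ and $\lambda\ll\pi$, then $\mu(A)=\infty$ for every $A\in\mathscr{L}(X)$ with $\lambda(A)\ne0$.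
   Context: $\lambda$ is Lebesgue measure and $\mathscr{L}(X)$ is the Lebesgue $\sigma$-algebra on $X$; measurable means Lebesgue measurable. Densities may take the value $\infty$ (even on sets of positive measure, so $\mu$ need not be $\sigma$-finite), with the convention $0\cdot\infty=0$. $\lambda\ll\pi$ means that $\pi(H)=0$ implies $\lambda(H)=0$ for $H\in\mathscr{L}(X)$. "Linear" means affine. $\ell$-Markov partition: Let $X\subseteq\mathbb{R}$ be a measurable set which is a countable union of closed intervals with non-empty interiors, and $f:X\to X$ measurable. $(X,f)$ has an $\ell$-Markov partition $\mathscr{H}$ if $\mathscr{H}$ is a countable (finite or countably infinite) set of closed subintervals of $\mathbb{R}$ with non-empty interior such that: (1) $\operatorname{int}(A)\cap\operatorname{int}(B)=\emptyset$ for distinct $A,B\in\mathscr{H}$; (2) $X=\bigcup\mathscr{H}$; (3) for all $A\in\mathscr{H}$ there is $\emptyset\ne\mathscr{A}\subseteq\mathscr{H}$ with $\operatorname{int}(f(A))=\operatorname{int}(\bigcup\mathscr{A})$; (4) $f$ is linear on the interior of each $H\in\mathscr{H}$. The elements of $\mathscr{H}$ are enumerated as $H_i$, with $i$ ranging over $\mathbb{Z}^+$ (or over $\{1,\dots,m\}$ if $\mathscr{H}$ has $m<\infty$ elements). For a finite sequence of indices let $H_{i_0\dots i_n}=\bigcap_{k=0}^n f^{-k}(H_{i_k})$. The partition is expansive if for every $\delta>0$ and every bounded interval $I\subseteq X$ there are finitely many finite index sequences $(i^{(k)}_0,\dots,i^{(k)}_{n_k})$, $1\le k\le N$, with $\lambda\big(I\,\Delta\,\bigcup_{k=1}^N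 H_{i^{(k)}_0\dots i^{(k)}_{n_k}}\big)<\delta$, where $\Delta$ denotes symmetric difference. Transition matrix (defined when all $\lambda(H_i)<\infty$): $P=(p_{ij})$ with $p_{ij}=\frac{\lambda(H_j)}{\lambda(H_i)\,|f'(H_i)|}$ if $\operatorname{int}(H_j)\subseteq f(H_i)$ and $p_{ij}=0$ otherwise, where $f'(H_i)$ is the slope of $f$ on $\operatorname{int}(H_i)$. $P$ is row-stochastic and defines a Markov chain on the index set; $p_{ij}^{(k)}=(P^k)_{ij}$. Positive recurrent means that every state is recurrent (return probability $1$) with finite mean return time. *)

theory Defs
  imports "HOL-Analysis.Analysis"
begin

section \<open>Markov partitions\<close>

definition nondeg_closed_interval :: "real set \<Rightarrow> bool" where
  "nondeg_closed_interval A \<longleftrightarrow> is_interval A \<and> closed A \<and> interior A \<noteq> {}"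

text \<open>The map \<open>f : X \<rightarrow> X\<close> is a total function whose values outside \<open>X\<close> are irrelevant;
  preimages are therefore always intersected with \<open>X\<close>.\<close>

definition dynamical_system :: "real set \<Rightarrow> (real \<Rightarrow> real) \<Rightarrow> bool" where
  "dynamical_system X f \<longleftrightarrow>
     X \<in> sets lebesgue \<and>
     (\<exists>\<C>. countable \<C> \<and> (\<forall>A\<in>\<C>. nondeg_closed_interval A) \<and> X = \<Union>\<C>) \<and>
     f \<in> lebesgue_on X \<rightarrow>\<^sub>M lebesgue_on X"

text \<open>``Linear'' means affine.\<close>

definition l_markov_partition :: "real set \<Rightarrow> (real \<Rightarrow> real) \<Rightarrow> real set set \<Rightarrow> bool" where
  "l_markov_partition X f \<H> \<longleftrightarrow>
     countable \<H> \<and>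
     (\<forall>A\<in>\<H>. nondeg_closed_interval A) \<and>
     (\<forall>A\<in>\<H>. \<forall>B\<in>\<H>. A \<noteq> B \<longrightarrow> interior A \<inter> interior B = {}) \<and>
     X = \<Union>\<H> \<and>
     (\<forall>A\<in>\<H>. \<exists>\<A>. \<A> \<noteq> {} \<and> \<A> \<subseteq> \<H> \<and> interior (f ` A) = interior (\<Union>\<A>)) \<and>
     (\<forall>A\<in>\<H>. \<exists>a b. \<forall>x\<in>interior A. f x = a * x + b)"

text \<open>The finite case includes \<open>m = 0\<close>, where \<open>{1..m}\<close> is empty.\<close>

definition enumerates :: "nat set \<Rightarrow> (nat \<Rightarrow> 'a) \<Rightarrow> 'a set \<Rightarrow> bool" where
  "enumerates J H \<H> \<longleftrightarrow> (J = {1..} \<or> (\<exists>m. J = {1..m})) \<and> bij_betw H J \<H>"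

text \<open>An index sequence \<open>i\<^sub>0, \<dots>, i\<^sub>n\<close> is a list of length \<open>n + 1\<close>, so only non-empty
  lists are meant; on the empty list the intersection would be the whole line.\<close>

definition cylinder :: "real set \<Rightarrow> (real \<Rightarrow> real) \<Rightarrow> (nat \<Rightarrow> real set) \<Rightarrow> nat list \<Rightarrow> real set" where
  "cylinder X f H is = (\<Inter>k<length is. (f ^^ k) -` H (is ! k) \<inter> X)"

definition expansive ::
  "real set \<Rightarrow> (real \<Rightarrow> real) \<Rightarrow> nat set \<Rightarrow> (nat \<Rightarrow> real set) \<Rightarrow> bool" where
  "expansive X f J H \<longleftrightarrow>
     (\<forall>\<delta>>0. \<forall>I. is_interval I \<and> bounded I \<and> I \<subseteq> X \<longrightarrow>
       (\<exists>W. finite W \<and> (\<forall>is\<in>W. is \<noteq> [] \<and> set is \<subseteq> J) \<and>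
            emeasure lebesgue (sym_diff I (\<Union>is\<in>W. cylinder X f H is)) < ennreal \<delta>))"

text \<open>Unique when \<open>f\<close> is affine on the non-empty interior of \<open>A\<close>.\<close>

definition slope :: "(real \<Rightarrow> real) \<Rightarrow> real set \<Rightarrow> real" where
  "slope f A = (THE a. \<exists>b. \<forall>x\<in>interior A. f x = a * x + b)"

definition transition_matrix :: "(real \<Rightarrow> real) \<Rightarrow> (nat \<Rightarrow> real set) \<Rightarrow> nat \<Rightarrow> nat \<Rightarrow> real" where
  "transition_matrix f H i j =
     (if interior (H j) \<subseteq> f ` H i
      then measure lebesgue (H j) / (measure lebesgue (H i) * \<bar>slope f (H i)\<bar>)
      else 0)"


section \<open>Markov chains on a countable state space\<close>

text \<open>A stochastic matrix with index set \<open>S\<close> is a function \<open>P\<close> of which only the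
  entries with both indices in \<open>S\<close> matter.\<close>

fun mat_pow :: "'a set \<Rightarrow> ('a \<Rightarrow> 'a \<Rightarrow> real) \<Rightarrow> nat \<Rightarrow> 'a \<Rightarrow> 'a \<Rightarrow> real" where
  "mat_pow S P 0 i j = (if i = j then 1 else 0)"
| "mat_pow S P (Suc k) i j = (\<Sum>\<^sub>\<infinity>l\<in>S. P i l * mat_pow S P k l j)"

definition irreducible_chain :: "'a set \<Rightarrow> ('a \<Rightarrow> 'a \<Rightarrow> real) \<Rightarrow> bool" where
  "irreducible_chain S P \<longleftrightarrow> (\<forall>i\<in>S. \<forall>j\<in>S. \<exists>k>0. mat_pow S P k i j > 0)"

definition aperiodic_chain :: "'a set \<Rightarrow> ('a \<Rightarrow> 'a \<Rightarrow> real) \<Rightarrow> bool" where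
  "aperiodic_chain S P \<longleftrightarrow> (\<forall>i\<in>S. Gcd {k. k > 0 \<and> mat_pow S P k i i > 0} = 1)"

text \<open>The probability that the chain started in \<open>i\<close> visits \<open>j\<close> at time \<open>n\<close> and at no
  time strictly between \<open>0\<close> and \<open>n\<close>, by conditioning on the first step. For \<open>i = j\<close> this
  is the distribution of the first return time.\<close>

fun first_passage :: "'a set \<Rightarrow> ('a \<Rightarrow> 'a \<Rightarrow> real) \<Rightarrow> nat \<Rightarrow> 'a \<Rightarrow> 'a \<Rightarrow> real" where
  "first_passage S P 0 i j = 0"
| "first_passage S P (Suc 0) i j = P i j"
| "first_passage S P (Suc (Suc n)) i j =
     (\<Sum>\<^sub>\<infinity>l\<in>S - {j}. P i l * first_passage S P (Suc n) l j)"

definition positive_recurrent :: "'a set \<Rightarrow> ('a \<Rightarrow> 'a \<Rightarrow> real) \<Rightarrow> bool" where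
  "positive_recurrent S P \<longleftrightarrow>
     (\<forall>i\<in>S. (\<lambda>n. first_passage S P n i i) sums 1 \<and>
            summable (\<lambda>n. real n * first_passage S P n i i))"


section \<open>Invariant measures and densities\<close>

definition invariant_measure :: "real set \<Rightarrow> (real \<Rightarrow> real) \<Rightarrow> real measure \<Rightarrow> bool" where
  "invariant_measure X f \<mu> \<longleftrightarrow>
     sets \<mu> = sets (lebesgue_on X) \<and>
     (\<forall>A\<in>sets (lebesgue_on X). emeasure \<mu> (f -` A \<inter> X) = emeasure \<mu> A)"

definition has_density :: "real set \<Rightarrow> real measure \<Rightarrow> (real \<Rightarrow> ennreal) \<Rightarrow> bool" where
  "has_density X \<mu> \<rho> \<longleftrightarrow>
     \<rho> \<in> borel_measurable (lebesgue_on X) \<and>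
     sets \<mu> = sets (lebesgue_on X) \<and>
     (\<forall>A\<in>sets (lebesgue_on X). emeasure \<mu> A = (\<integral>\<^sup>+x\<in>A. \<rho> x \<partial>lebesgue_on X))"

end

(*
  Two densities that are invariant under f have an invariant pointwise minimum as soon as one of them
  is integrable: splitting a set A into {g <= h} and {g > h} shows that min g h assigns at most as much
  mass to the preimage of A as to A, and applying this to A and to its complement forces equality.

  Positive recurrence gives a finite stationary vector gamma (expected number of visits during one
  excursion), and spreading each gamma_j uniformly over H_j gives an integrable invariant density
  h > 0. For the given density rho, the difference min rho ((n+1)h) - min rho (n h) is an integrable
  invariant density whose support is exactly {rho > n h}, so this set is invariant modulo null sets.
  By ergodicity it is null or of full measure. If it is null for some n, then mu(X) <= n * int h is
  finite; otherwise rho = infinity almost everywhere.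

  For ergodicity, the relative frequencies of an invariant set B in the H_i form a bounded harmonic
  function of the chain, hence a constant c. Affinity of the branches carries this over to cylinders and,
  by expansivity, to all intervals in X, so that B has density c at every scale and c is 0 or 1.
*)
theory Submission
  imports Defs
begin

section \<open>Invariant densities\<close>

text \<open>Densities take values in \<open>ennreal\<close> and no finiteness is built in, so the
  notion covers both the given \<open>\<rho>\<close>, possibly infinite on large sets, and the
  integrable densities it is compared with.\<close>

definition invariant_density :: "'a measure \<Rightarrow> ('a \<Rightarrow> 'a) \<Rightarrow> ('a \<Rightarrow> ennreal) \<Rightarrow> bool" where
  "invariant_density M T g \<longleftrightarrow> g \<in> borel_measurable M \<and>
     (\<forall>A\<in>sets M. emeasure (density M g) (T -` A \<inter> space M) = emeasure (density M g) A)"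

text \<open>Turns one-sided estimates for a set and for its complement into equalities. Finiteness
  of the total is what allows cancellation in \<open>ennreal\<close>.\<close>

lemma ennreal_add_le_cancel:
  fixes a b a' b' :: ennreal
  assumes "a' \<le> a" "b' \<le> b" "a + b \<le> a' + b'" "a + b < \<infinity>"
  shows "a' = a"
proof -
  have "b < \<infinity>" using assms(4) by (simp add: ennreal_add_less_top)
  moreover have "a + b \<le> a' + b"
    using assms(2,3) by (meson add_left_mono order_trans)
  ultimately have "a \<le> a'"
    by (metis add.commute ennreal_add_left_cancel_le infinity_ennreal_def top.not_eq_extremum)
  with assms(1) show ?thesis by simp
qed

lemma emeasure_density_mono:
  assumes [measurable]: "g \<in> borel_measurable M" "h \<in> borel_measurable M" "A \<in> sets M"
    and "\<And>x. x \<in> A \<Longrightarrow> g x \<le> h x"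
  shows "emeasure (density M g) A \<le> emeasure (density M h) A"
  using assms(4) by (auto simp: emeasure_density intro!: nn_integral_mono split: split_indicator)

lemma emeasure_density_cong:
  assumes [measurable]: "g \<in> borel_measurable M" "h \<in> borel_measurable M" "A \<in> sets M"
    and "\<And>x. x \<in> A \<Longrightarrow> g x = h x"
  shows "emeasure (density M g) A = emeasure (density M h) A"
  using assms(4) by (auto simp: emeasure_density intro!: nn_integral_cong split: split_indicator)

lemma emeasure_density_space:
  "g \<in> borel_measurable M \<Longrightarrow> emeasure (density M g) (space M) = (\<integral>\<^sup>+x. g x \<partial>M)"
  by (simp add: emeasure_density)

text \<open>Integrability of \<open>h\<close> makes the total mass of the minimum finite even where
  \<open>g\<close> is infinite, so the inequality for a set and the one for its complement can be
  cancelled against each other.\<close>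

lemma invariant_density_min:
  assumes T [measurable]: "T \<in> M \<rightarrow>\<^sub>M M"
    and g: "invariant_density M T g" and h: "invariant_density M T h"
    and fin: "(\<integral>\<^sup>+x. h x \<partial>M) < \<infinity>"
  shows "invariant_density M T (\<lambda>x. min (g x) (h x))"
proof -
  have [measurable]: "g \<in> borel_measurable M" "h \<in> borel_measurable M"
    using g h by (auto simp: invariant_density_def)
  define D where "D = density M (\<lambda>x. min (g x) (h x))"
  have sets_D [simp, measurable_cong]: "sets D = sets M" by (simp add: D_def)
  have space_D [simp]: "space D = space M" by (simp add: D_def)
  have le: "emeasure D (T -` A \<inter> space M) \<le> emeasure D A" if [measurable]: "A \<in> sets M" for A
  proof -
    define B where "B = {x \<in> A. g x \<le> h x}"
    have "B = {x \<in> space M. x \<in> A \<and> g x \<le> h x}"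
      using sets.sets_into_space[OF that] by (auto simp: B_def)
    then have B [measurable]: "B \<in> sets M" by simp
    have "emeasure D (T -` A \<inter> space M)
        = emeasure D (T -` B \<inter> space M) + emeasure D (T -` (A - B) \<inter> space M)"
      by (subst plus_emeasure) (auto simp: B_def intro!: arg_cong2[where f=emeasure])
    \<comment> \<open>The minimum is at most either function. Each piece is estimated by the
      function that realizes the minimum on the piece itself, so that returning from the preimage
      loses nothing.\<close>
    also have "\<dots> \<le> emeasure (density M g) (T -` B \<inter> space M)
                    + emeasure (density M h) (T -` (A - B) \<inter> space M)"
      unfolding D_def by (intro add_mono emeasure_density_mono) auto
    also have "\<dots> = emeasure (density M g) B + emeasure (density M h) (A - B)"
      using g h by (simp add: invariant_density_def)
    also have "\<dots> = emeasure D B + emeasure D (A - B)"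
      unfolding D_def by (intro arg_cong2[where f="(+)"] emeasure_density_cong) (auto simp: B_def min_def)
    also have "\<dots> = emeasure D A"
      by (subst plus_emeasure) (auto simp: B_def intro!: arg_cong2[where f=emeasure])
    finally show ?thesis .
  qed
  have "emeasure D (T -` A \<inter> space M) = emeasure D A" if [measurable]: "A \<in> sets M" for A
  proof (rule ennreal_add_le_cancel)
    show "emeasure D (T -` A \<inter> space M) \<le> emeasure D A" by (intro le) simp
    show "emeasure D (T -` (space M - A) \<inter> space M) \<le> emeasure D (space M - A)" by (intro le) simp
    have "emeasure D A + emeasure D (space M - A) = emeasure D (space M)"
      using sets.sets_into_space[OF that]
      by (subst plus_emeasure) (auto intro!: arg_cong2[where f=emeasure])
    moreover have "emeasure D (space M) \<le> (\<integral>\<^sup>+x. h x \<partial>M)"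
      by (auto simp: D_def emeasure_density intro!: nn_integral_mono)
    ultimately show "emeasure D A + emeasure D (space M - A) < \<infinity>"
      using fin by simp
    have "emeasure D (T -` A \<inter> space M) + emeasure D (T -` (space M - A) \<inter> space M)
        = emeasure D (space M)"
      using measurable_space[OF T]
      by (subst plus_emeasure) (auto intro!: arg_cong2[where f=emeasure])
    then show "emeasure D A + emeasure D (space M - A)
        \<le> emeasure D (T -` A \<inter> space M) + emeasure D (T -` (space M - A) \<inter> space M)"
      using \<open>emeasure D A + _ = _\<close> by simp
  qed
  then show ?thesis by (simp add: invariant_density_def D_def)
qed

lemma invariant_density_cmult:
  assumes "invariant_density M T g" "T \<in> M \<rightarrow>\<^sub>M M"
  shows "invariant_density M T (\<lambda>x. c * g x)"
proof -
  have [measurable]: "g \<in> borel_measurable M" "T \<in> M \<rightarrow>\<^sub>M M"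
    using assms by (auto simp: invariant_density_def)
  have "emeasure (density M (\<lambda>x. c * g x)) A = c * emeasure (density M g) A"
    if [measurable]: "A \<in> sets M" for A
    by (simp add: emeasure_density nn_integral_cmult mult.assoc)
  then show ?thesis using assms by (simp add: invariant_density_def)
qed

text \<open>Let \<open>B\<close> be the support of \<open>g\<close>. Its preimage \<open>B'\<close>
  carries the full finite \<open>g\<close>-mass, so \<open>B\<close> lies in \<open>B'\<close> up to
  a null set. The finite invariant measure with positive density \<open>h\<close> gives both sets
  the same mass, so the difference is null for it and therefore for \<open>M\<close>.\<close>

lemma AE_invariant_support:
  assumes T [measurable]: "T \<in> M \<rightarrow>\<^sub>M M"
    and g: "invariant_density M T g" "(\<integral>\<^sup>+x. g x \<partial>M) < \<infinity>"
    and h: "invariant_density M T h" "(\<integral>\<^sup>+x. h x \<partial>M) < \<infinity>" "\<And>x. x \<in> space M \<Longrightarrow> 0 < h x"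
  shows "AE x in M. 0 < g (T x) \<longleftrightarrow> 0 < g x"
proof -
  have [measurable]: "g \<in> borel_measurable M" "h \<in> borel_measurable M"
    using g h by (auto simp: invariant_density_def)
  define B where "B = {x \<in> space M. 0 < g x}"
  define B' where "B' = T -` B \<inter> space M"
  have B [measurable]: "B \<in> sets M" "B' \<in> sets M" by (simp_all add: B_def B'_def)
  have "emeasure (density M g) B' = emeasure (density M g) B"
    using g(1) by (simp add: B'_def invariant_density_def)
  also have "\<dots> = emeasure (density M g) (space M)"
    by (auto simp: emeasure_density B_def intro!: nn_integral_cong split: split_indicator)
  finally have "emeasure (density M g) (space M - B') = 0"
    using g(2) by (subst emeasure_compl[of B' "density M g", simplified])
                  (auto simp: emeasure_density top.not_eq_extremum)
  then have "AE x in M. g x * indicator (space M - B') x = 0"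
    by (simp add: emeasure_density nn_integral_0_iff_AE)
  then have B_sub: "AE x in M. x \<in> B \<longrightarrow> x \<in> B'"
    by eventually_elim (auto simp: B_def split: split_indicator_asm)
  have eq: "emeasure (density M h) B' = emeasure (density M h) B"
    using h(1) by (simp add: B'_def invariant_density_def)
  have fin: "emeasure (density M h) A < \<infinity>" for A
  proof -
    have "emeasure (density M h) A \<le> emeasure (density M h) (space M)"
      using emeasure_space[of "density M h" A] by simp
    also have "\<dots> < \<infinity>" using h(2) by (simp add: emeasure_density)
    finally show ?thesis .
  qed
  have "emeasure (density M h) B' = emeasure (density M h) (B' - B) + emeasure (density M h) (B' \<inter> B)"
    by (subst plus_emeasure) (auto intro!: arg_cong2[where f=emeasure])
  also have "emeasure (density M h) (B' \<inter> B) = emeasure (density M h) B"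
  proof (rule emeasure_eq_AE)
    show "AE x in density M h. x \<in> B' \<inter> B \<longleftrightarrow> x \<in> B"
      using B_sub by (subst AE_density) (auto elim!: eventually_mono)
  qed auto
  finally have "emeasure (density M h) (B' - B) = 0"
    using fin[of B] eq by (metis add.commute add.right_neutral ennreal_add_left_cancel infinity_ennreal_def top.not_eq_extremum)
  then have "AE x in M. h x * indicator (B' - B) x = 0"
    by (simp add: emeasure_density nn_integral_0_iff_AE)
  moreover have "AE x in M. x \<in> space M" by simp
  ultimately have "AE x in M. x \<in> B' \<longrightarrow> x \<in> B"
  proof eventually_elim
    case (elim x)
    then show ?case using h(3)[of x] by (auto split: split_indicator_asm)
  qed
  moreover have "AE x in M. x \<in> space M" by simp
  ultimately show ?thesis using B_sub
  proof eventually_elim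
    case (elim x)
    then show ?case using measurable_space[OF T, of x] by (auto simp: B_def B'_def)
  qed
qed

text \<open>The relation is stated as a sum because subtraction in \<open>ennreal\<close> is
  unreliable at infinity. The finite mass of \<open>h\<close> can be cancelled, whatever the masses
  of \<open>g\<close> and \<open>k\<close> are.\<close>

lemma invariant_density_diff:
  assumes T [measurable]: "T \<in> M \<rightarrow>\<^sub>M M" and [measurable]: "k \<in> borel_measurable M"
    and g: "invariant_density M T g" and h: "invariant_density M T h" "(\<integral>\<^sup>+x. h x \<partial>M) < \<infinity>"
    and eq: "\<And>x. x \<in> space M \<Longrightarrow> g x = h x + k x"
  shows "invariant_density M T k"
proof -
  have [measurable]: "g \<in> borel_measurable M" "h \<in> borel_measurable M"
    using g h by (auto simp: invariant_density_def)
  have sum: "emeasure (density M g) A = emeasure (density M h) A + emeasure (density M k) A"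
    if [measurable]: "A \<in> sets M" for A
  proof -
    have "emeasure (density M g) A = (\<integral>\<^sup>+x. h x * indicator A x + k x * indicator A x \<partial>M)"
      by (auto simp: emeasure_density eq intro!: nn_integral_cong split: split_indicator)
    then show ?thesis by (simp add: nn_integral_add emeasure_density)
  qed
  have fin: "emeasure (density M h) A \<noteq> top" for A
  proof -
    have "emeasure (density M h) A \<le> emeasure (density M h) (space M)"
      using emeasure_space[of "density M h" A] by simp
    also have "\<dots> < \<infinity>" using h(2) by (simp add: emeasure_density)
    finally show ?thesis by auto
  qed
  show ?thesis
    unfolding invariant_density_def
  proof safe
    fix A assume A [measurable]: "A \<in> sets M"
    have "emeasure (density M h) A + emeasure (density M k) (T -` A \<inter> space M)
        = emeasure (density M h) A + emeasure (density M k) A"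
      using sum[OF A] sum[of "T -` A \<inter> space M"] g h(1) by (auto simp: invariant_density_def)
    then show "emeasure (density M k) (T -` A \<inter> space M) = emeasure (density M k) A"
      using fin[of A] by (simp add: ennreal_add_left_cancel)
  qed simp
qed

text \<open>The superlevel set is the support of the integrable invariant density
  \<open>up - low\<close>, to which \<open>AE_invariant_support\<close> applies.\<close>

lemma AE_superlevel_invariant:
  fixes n :: nat
  assumes T [measurable]: "T \<in> M \<rightarrow>\<^sub>M M"
    and \<rho>: "invariant_density M T \<rho>"
    and h: "invariant_density M T h" "(\<integral>\<^sup>+x. h x \<partial>M) < \<infinity>" "\<And>x. x \<in> space M \<Longrightarrow> 0 < h x"
  shows "AE x in M. of_nat n * h (T x) < \<rho> (T x) \<longleftrightarrow> of_nat n * h x < \<rho> x"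
proof -
  have [measurable]: "\<rho> \<in> borel_measurable M" "h \<in> borel_measurable M"
    using \<rho> h by (auto simp: invariant_density_def)
  define low where "low x = min (\<rho> x) (of_nat n * h x)" for x
  define up where "up x = min (\<rho> x) (of_nat (Suc n) * h x)" for x
  \<comment> \<open>Where the condition holds, \<open>of_nat n * h x\<close> is finite and the
    subtraction is genuine. Elsewhere the value must be 0, whereas \<open>top - top\<close> would be
    \<open>top\<close> in \<open>ennreal\<close>.\<close>
  define g where "g x = (if of_nat n * h x < \<rho> x then up x - of_nat n * h x else 0)" for x
  have [measurable]: "g \<in> borel_measurable M"
    unfolding g_def[abs_def] up_def by measurable
  have fin_mult: "(\<integral>\<^sup>+x. of_nat m * h x \<partial>M) < \<infinity>" for m
    using h(2) by (simp add: nn_integral_cmult ennreal_mult_less_top of_nat_less_top)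
  have inv_low: "invariant_density M T low" and inv_up: "invariant_density M T up"
    unfolding low_def up_def
    by (intro invariant_density_min T \<rho> invariant_density_cmult h fin_mult)+
  have fin_low: "(\<integral>\<^sup>+x. low x \<partial>M) < \<infinity>"
    by (rule le_less_trans[OF _ fin_mult[of n]]) (auto simp: low_def intro!: nn_integral_mono)
  have less: "of_nat n * h x < up x" if "of_nat n * h x < \<rho> x" "x \<in> space M" for x
  proof -
    have "of_nat n * h x \<noteq> top" using that by auto
    then have "of_nat n * h x + 0 < of_nat n * h x + h x"
      using h(3)[OF that(2)] by (subst ennreal_add_left_cancel_less) auto
    then show ?thesis using that by (simp add: up_def distrib_right add.commute)
  qed
  have eq: "up x = low x + g x" if "x \<in> space M" for x
  proof (cases "of_nat n * h x < \<rho> x")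
    case True
    then have "low x = of_nat n * h x" unfolding low_def by (intro min.absorb2 less_imp_le)
    then show ?thesis using less[OF True that] True
      by (simp add: g_def add_diff_inverse_ennreal)
  next
    case False
    moreover have "of_nat n * h x \<le> of_nat (Suc n) * h x" by (intro mult_right_mono) auto
    ultimately have "low x = \<rho> x" "up x = \<rho> x" "g x = 0"
      by (auto simp: low_def up_def g_def not_less intro!: min.absorb1 intro: order_trans)
    then show ?thesis by simp
  qed
  have "invariant_density M T g"
    by (rule invariant_density_diff[OF T _ inv_up inv_low fin_low eq]) auto
  moreover have "(\<integral>\<^sup>+x. g x \<partial>M) < \<infinity>"
  proof (rule le_less_trans[OF _ fin_mult[of "Suc n"]])
    have "g x \<le> of_nat (Suc n) * h x" if "x \<in> space M" for x
    proof -
      have "g x \<le> up x" using eq[OF that] by simp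
      also have "\<dots> \<le> of_nat (Suc n) * h x" unfolding up_def by (rule min.cobounded2)
      finally show ?thesis .
    qed
    then show "(\<integral>\<^sup>+x. g x \<partial>M) \<le> (\<integral>\<^sup>+x. of_nat (Suc n) * h x \<partial>M)"
      by (intro nn_integral_mono)
  qed
  ultimately have "AE x in M. 0 < g (T x) \<longleftrightarrow> 0 < g x"
    by (rule AE_invariant_support[OF T _ _ h])
  moreover have "0 < g x \<longleftrightarrow> of_nat n * h x < \<rho> x" if "x \<in> space M" for x
    using less[OF _ that] by (auto simp: g_def diff_gr0_ennreal)
  moreover have "AE x in M. x \<in> space M" by simp
  ultimately show ?thesis
    using measurable_space[OF T] by (auto elim!: eventually_mono)
qed

section \<open>Stationary vectors and harmonic functions of recurrent chains\<close>

lemma nn_integral_count_space_swap: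
  fixes f :: "'a \<Rightarrow> 'b \<Rightarrow> ennreal"
  assumes "countable A"
  shows "(\<integral>\<^sup>+x. \<integral>\<^sup>+y. f x y \<partial>count_space A \<partial>count_space B)
       = (\<integral>\<^sup>+y. \<integral>\<^sup>+x. f x y \<partial>count_space B \<partial>count_space A)"
  by (rule nn_integral_count_space_nn_integral[OF assms]) simp

lemma nn_integral_count_space_remove:
  "(\<integral>\<^sup>+x. g x \<partial>count_space (A - {a})) = (\<integral>\<^sup>+x. (if x = a then 0 else g x) \<partial>count_space A)"
  by (simp add: nn_integral_count_space_indicator)
     (auto intro!: nn_integral_cong split: split_indicator)

lemma nn_integral_count_space_single:
  "a \<in> A \<Longrightarrow> (\<integral>\<^sup>+x. (if x = a then 1 else 0) * g x \<partial>count_space A) = g a"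
proof -
  assume a: "a \<in> A"
  have "(\<integral>\<^sup>+x. (if x = a then 1 else 0) * g x \<partial>count_space A)
      = (\<integral>\<^sup>+x. g x * indicator {a} x \<partial>count_space A)"
    by (intro nn_integral_cong) (auto split: split_indicator)
  then show ?thesis using a by (simp add: nn_integral_indicator_singleton')
qed

text \<open>Moves from \<open>infsum\<close>, used in the definition of first passage probabilities,
  to \<open>ennreal\<close>, where sums can be exchanged freely. Finiteness rules out the default
  value 0 of a divergent \<open>infsum\<close>.\<close>

lemma nn_integral_count_space_infsum:
  fixes g :: "'a \<Rightarrow> real"
  assumes nn: "\<And>x. x \<in> A \<Longrightarrow> 0 \<le> g x" and fin: "(\<integral>\<^sup>+x. ennreal (g x) \<partial>count_space A) < \<infinity>"
  shows "ennreal (infsum g A) = (\<integral>\<^sup>+x. ennreal (g x) \<partial>count_space A)"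
proof -
  have "(\<integral>\<^sup>+x. ennreal (norm (g x)) \<partial>count_space A) = (\<integral>\<^sup>+x. ennreal (g x) \<partial>count_space A)"
    by (intro nn_integral_cong) (simp add: nn)
  then have "Infinite_Set_Sum.abs_summable_on g A"
    using fin by (auto simp: abs_summable_on_def integrable_iff_bounded)
  then show ?thesis
    using nn_integral_conv_infsetsum[of g A] nn by (simp add: infsetsum_infsum)
qed

text \<open>The nonnegative difference has integral 0, and counting measure has no null
  points.\<close>

lemma nn_integral_count_space_eqD:
  assumes le: "\<And>x. x \<in> A \<Longrightarrow> f x \<le> g x"
    and ge: "(\<integral>\<^sup>+x. g x \<partial>count_space A) \<le> (\<integral>\<^sup>+x. f x \<partial>count_space A)"
    and fin: "(\<integral>\<^sup>+x. g x \<partial>count_space A) < \<infinity>" and a: "a \<in> A"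
  shows "f a = g a"
proof -
  have le': "(\<integral>\<^sup>+x. f x \<partial>count_space A) \<le> (\<integral>\<^sup>+x. g x \<partial>count_space A)"
    by (intro nn_integral_mono) (simp add: le)
  have "(\<integral>\<^sup>+x. g x - f x \<partial>count_space A)
      = (\<integral>\<^sup>+x. g x \<partial>count_space A) - (\<integral>\<^sup>+x. f x \<partial>count_space A)"
    using fin le' by (intro nn_integral_diff) (auto simp: AE_count_space le)
  also have "\<dots> = 0" using ge fin by (simp add: diff_eq_0_iff_ennreal)
  finally have "\<forall>x\<in>A. g x - f x = 0" by (simp add: nn_integral_0_iff_AE AE_count_space)
  then show ?thesis using le[OF a] a by (auto simp: diff_eq_0_iff_ennreal intro: antisym)
qed

text \<open>A set that no single transition leaves is not left in any number of steps, so all powers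
  of the matrix vanish from \<open>i\<close> to a state outside it. This is how irreducibility is
  used throughout.\<close>

lemma irreducible_chain_closed:
  assumes irr: "irreducible_chain S P" and i: "i \<in> S" "i \<in> C"
    and closed: "\<And>i j. i \<in> S \<Longrightarrow> i \<in> C \<Longrightarrow> j \<in> S \<Longrightarrow> P i j \<noteq> 0 \<Longrightarrow> j \<in> C"
  shows "S \<subseteq> C"
proof
  fix j assume j: "j \<in> S"
  have "mat_pow S P k i j = 0" if "j \<notin> C" for k
    using i
  proof (induction k arbitrary: i)
    case (Suc k)
    have "P i l * mat_pow S P k l j = 0" if "l \<in> S" for l
      using Suc closed[of i l] that by (cases "P i l = 0") auto
    then show ?case by (simp add: infsum_0)
  qed (use that in auto)
  moreover obtain k where "mat_pow S P k i j > 0"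
    using irr i j by (auto simp: irreducible_chain_def)
  ultimately show "j \<in> C" by (metis less_irrefl)
qed

section \<open>Stationary vectors, harmonic functions and excursions of a stochastic matrix\<close>

locale stochastic_matrix =
  fixes S :: "'a set" and P :: "'a \<Rightarrow> 'a \<Rightarrow> real"
  assumes countable_S [simp]: "countable S"
    and nonneg: "\<And>i j. i \<in> S \<Longrightarrow> j \<in> S \<Longrightarrow> 0 \<le> P i j"
    and row_sum: "\<And>i. i \<in> S \<Longrightarrow> (\<integral>\<^sup>+j. ennreal (P i j) \<partial>count_space S) = 1"
begin

definition stationary :: "('a \<Rightarrow> ennreal) \<Rightarrow> bool" where
  "stationary \<gamma> \<longleftrightarrow> (\<forall>j\<in>S. (\<integral>\<^sup>+i. \<gamma> i * ennreal (P i j) \<partial>count_space S) = \<gamma> j)"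

text \<open>Positivity spreads along transitions, since one term of the stationarity equation
  already bounds \<open>\<gamma> l\<close> from below.\<close>

lemma stationary_pos:
  assumes irr: "irreducible_chain S P" and st: "stationary \<gamma>"
    and i: "i \<in> S" "0 < \<gamma> i" and j: "j \<in> S"
  shows "0 < \<gamma> j"
proof -
  have "S \<subseteq> {j. 0 < \<gamma> j}"
  proof (rule irreducible_chain_closed[OF irr i(1)])
    fix k l assume *: "k \<in> S" "k \<in> {j. 0 < \<gamma> j}" "l \<in> S" "P k l \<noteq> 0"
    then have "0 < \<gamma> k * ennreal (P k l)"
      using nonneg[of k l] by (simp add: ennreal_zero_less_mult_iff)
    also have "\<dots> \<le> (\<integral>\<^sup>+i. \<gamma> i * ennreal (P i l) \<partial>count_space S)"
      using * by (intro nn_integral_ge_point) auto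
    also have "\<dots> = \<gamma> l" using st * by (simp add: stationary_def)
    finally show "l \<in> {j. 0 < \<gamma> j}" by simp
  qed (use i in auto)
  then show ?thesis using j by auto
qed

text \<open>A maximum principle. Truncating \<open>h\<close> at its value \<open>c\<close> in
  \<open>i\<close> gives a superharmonic function \<open>m\<close>. Integration against the finite
  stationary vector shows that \<open>m\<close> is in fact harmonic, and as it attains its upper
  bound \<open>c\<close> at \<open>i\<close>, it equals \<open>c\<close> everywhere.\<close>

lemma harmonic_le:
  assumes irr: "irreducible_chain S P" and st: "stationary \<gamma>"
    and pos: "\<And>i. i \<in> S \<Longrightarrow> 0 < \<gamma> i" and fin: "(\<integral>\<^sup>+i. \<gamma> i \<partial>count_space S) < \<infinity>"
    and harm: "\<And>i. i \<in> S \<Longrightarrow> (\<integral>\<^sup>+j. ennreal (P i j) * h j \<partial>count_space S) = h i"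
    and i: "i \<in> S" "h i < \<infinity>" and j: "j \<in> S"
  shows "h i \<le> h j"
proof -
  define c where "c = h i"
  define m where "m k = min (h k) c" for k
  define q where "q k = (\<integral>\<^sup>+l. ennreal (P k l) * m l \<partial>count_space S)" for k
  have const: "(\<integral>\<^sup>+l. ennreal (P k l) * c \<partial>count_space S) = c" if "k \<in> S" for k
    using row_sum[OF that] by (simp add: nn_integral_multc)
  have q_le: "q k \<le> m k" if k: "k \<in> S" for k
  proof -
    have "q k \<le> h k"
      unfolding q_def harm[OF k, symmetric] by (auto simp: m_def intro!: nn_integral_mono mult_left_mono)
    moreover have "q k \<le> (\<integral>\<^sup>+l. ennreal (P k l) * c \<partial>count_space S)"
      unfolding q_def by (auto simp: m_def intro!: nn_integral_mono mult_left_mono)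
    ultimately show ?thesis using const[OF k] by (simp add: m_def)
  qed
  have \<gamma>_fin: "\<gamma> k < \<infinity>" if "k \<in> S" for k
    using nn_integral_ge_point[OF that, of \<gamma>] fin by (rule le_less_trans)
  have "(\<integral>\<^sup>+k. \<gamma> k * q k \<partial>count_space S)
      = (\<integral>\<^sup>+k. \<integral>\<^sup>+l. \<gamma> k * (ennreal (P k l) * m l) \<partial>count_space S \<partial>count_space S)"
    by (simp add: q_def nn_integral_cmult)
  also have "\<dots> = (\<integral>\<^sup>+l. \<integral>\<^sup>+k. \<gamma> k * ennreal (P k l) * m l \<partial>count_space S \<partial>count_space S)"
    by (subst nn_integral_count_space_swap) (simp_all add: mult.assoc)
  also have "\<dots> = (\<integral>\<^sup>+l. \<gamma> l * m l \<partial>count_space S)"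
    using st by (intro nn_integral_cong) (simp add: nn_integral_multc stationary_def)
  finally have eq: "(\<integral>\<^sup>+k. \<gamma> k * q k \<partial>count_space S) = (\<integral>\<^sup>+k. \<gamma> k * m k \<partial>count_space S)" .
  have fin': "(\<integral>\<^sup>+k. \<gamma> k * m k \<partial>count_space S) < \<infinity>"
  proof -
    have "(\<integral>\<^sup>+k. \<gamma> k * m k \<partial>count_space S) \<le> (\<integral>\<^sup>+k. \<gamma> k * c \<partial>count_space S)"
      by (auto simp: m_def intro!: nn_integral_mono mult_left_mono)
    also have "\<dots> < \<infinity>" using fin i(2) by (simp add: nn_integral_multc c_def ennreal_mult_less_top)
    finally show ?thesis .
  qed
  \<comment> \<open>The sums of \<open>\<gamma> k * q k\<close> and \<open>\<gamma> k * m k\<close>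
    are equal and finite while the terms are ordered, so the terms agree. The weight
    \<open>\<gamma> k\<close> is positive and finite and can be cancelled.\<close>
  have q_eq: "q k = m k" if k: "k \<in> S" for k
  proof -
    have "\<gamma> k * q k = \<gamma> k * m k"
      by (rule nn_integral_count_space_eqD[OF _ _ fin' k]) (auto simp: eq intro: mult_left_mono q_le)
    then show ?thesis using pos[OF k] \<gamma>_fin[OF k]
      by (subst (asm) ennreal_mult_cancel_left) auto
  qed
  have "S \<subseteq> {k. m k = c}"
  proof (rule irreducible_chain_closed[OF irr i(1)])
    fix k l assume *: "k \<in> S" "k \<in> {k. m k = c}" "l \<in> S" "P k l \<noteq> 0"
    \<comment> \<open>An average of values at most \<open>c\<close> equals \<open>c\<close> only if
      every value with positive weight is \<open>c\<close>.\<close>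
    have "ennreal (P k l) * m l = ennreal (P k l) * c"
    proof (rule nn_integral_count_space_eqD[OF _ _ _ \<open>l \<in> S\<close>])
      show "(\<integral>\<^sup>+l. ennreal (P k l) * c \<partial>count_space S)
          \<le> (\<integral>\<^sup>+l. ennreal (P k l) * m l \<partial>count_space S)"
        using q_eq[OF *(1)] * by (simp add: const q_def)
      show "(\<integral>\<^sup>+l. ennreal (P k l) * c \<partial>count_space S) < \<infinity>"
        using const[OF *(1)] i(2) by (simp add: c_def)
    qed (auto simp: m_def intro: mult_left_mono)
    then show "l \<in> {k. m k = c}"
      using * nonneg[of k l] by (subst (asm) ennreal_mult_cancel_left) auto
  qed (auto simp: m_def c_def)
  then show ?thesis using j by (auto simp: m_def c_def min_def split: if_splits)
qed

text \<open>\<open>taboo_prob i n j\<close> is the probability that the chain started in \<open>i\<close> is in \<open>j\<close> at time \<open>n\<close>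
  without having returned to \<open>i\<close>. Its sum over \<open>n\<close> is the stationary vector.\<close>
primrec taboo_prob :: "'a \<Rightarrow> nat \<Rightarrow> 'a \<Rightarrow> ennreal" where
  "taboo_prob i 0 j = (if j = i then 1 else 0)"
| "taboo_prob i (Suc n) j =
     (if j = i then 0 else \<integral>\<^sup>+l. taboo_prob i n l * ennreal (P l j) \<partial>count_space S)"

lemma entry_le_1: "i \<in> S \<Longrightarrow> j \<in> S \<Longrightarrow> P i j \<le> 1"
  using nn_integral_ge_point[of j S "\<lambda>j. ennreal (P i j)"] by (simp add: row_sum)

text \<open>The bounds and the \<open>ennreal\<close> form of the recursion depend on each other:
  the bounds make the \<open>infsum\<close> converge, and the recursion then bounds the next
  probability by a row sum.\<close>

lemma first_passage_Suc_Suc: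
  assumes "i \<in> S" "l \<in> S"
  shows "0 \<le> first_passage S P (Suc n) l i \<and> first_passage S P (Suc n) l i \<le> 1 \<and>
    ennreal (first_passage S P (Suc (Suc n)) l i) =
      (\<integral>\<^sup>+k. (if k = i then 0 else ennreal (P l k) * ennreal (first_passage S P (Suc n) k i))
         \<partial>count_space S)"
  using \<open>l \<in> S\<close>
proof (induction n arbitrary: l)
  have step: "ennreal (first_passage S P (Suc (Suc n)) l i) =
        (\<integral>\<^sup>+k. (if k = i then 0 else ennreal (P l k) * ennreal (first_passage S P (Suc n) k i))
           \<partial>count_space S) \<and>
      (\<integral>\<^sup>+k. (if k = i then 0 else ennreal (P l k) * ennreal (first_passage S P (Suc n) k i))
           \<partial>count_space S) \<le> 1"
    if l: "l \<in> S" and bd: "\<And>k. k \<in> S \<Longrightarrow> 0 \<le> first_passage S P (Suc n) k i \<and> first_passage S P (Suc n) k i \<le> 1"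
    for n l
  proof -
    let ?I = "\<integral>\<^sup>+k. (if k = i then 0 else ennreal (P l k) * ennreal (first_passage S P (Suc n) k i))
           \<partial>count_space S"
    have "?I \<le> (\<integral>\<^sup>+k. ennreal (P l k) \<partial>count_space S)"
    proof (intro nn_integral_mono)
      fix k assume "k \<in> space (count_space S)"
      then have "ennreal (P l k) * ennreal (first_passage S P (Suc n) k i) \<le> ennreal (P l k) * 1"
        using bd[of k] by (intro mult_left_mono) auto
      then show "(if k = i then 0 else ennreal (P l k) * ennreal (first_passage S P (Suc n) k i)) \<le> ennreal (P l k)"
        by simp
    qed
    then have le: "?I \<le> 1" using row_sum[OF l] by simp
    have eq: "?I = (\<integral>\<^sup>+k. ennreal (P l k * first_passage S P (Suc n) k i) \<partial>count_space (S - {i}))"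
      unfolding nn_integral_count_space_remove
      using bd nonneg[OF l] by (intro nn_integral_cong) (auto simp: ennreal_mult)
    have "ennreal (first_passage S P (Suc (Suc n)) l i) = ?I"
      unfolding eq first_passage.simps
    proof (rule nn_integral_count_space_infsum)
      show "(\<integral>\<^sup>+k. ennreal (P l k * first_passage S P (Suc n) k i) \<partial>count_space (S - {i})) < \<infinity>"
        using le unfolding eq by (rule le_less_trans) simp
    qed (use bd nonneg[OF l] in auto)
    with le show ?thesis by simp
  qed
  {
    case 0
    then show ?case
      using step[of l 0] nonneg[OF _ \<open>i \<in> S\<close>] entry_le_1[OF _ \<open>i \<in> S\<close>] by auto
  next
    case (Suc n)
    have IH: "0 \<le> first_passage S P (Suc n) k i \<and> first_passage S P (Suc n) k i \<le> 1" if "k \<in> S" for k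
      using Suc.IH[OF that] by blast
    \<comment> \<open>Nonnegativity is shown over the reals, because the \<open>ennreal\<close>
      equation would also hide a negative value, which \<open>ennreal\<close> sends to 0.\<close>
    have nn: "0 \<le> first_passage S P (Suc (Suc n)) k i" if "k \<in> S" for k
      using IH nonneg[OF that] by (auto intro!: infsum_nonneg)
    have "first_passage S P (Suc (Suc n)) k i \<le> 1" if "k \<in> S" for k
      using step[OF that IH] ennreal_le_1 by metis
    with nn step[OF Suc.prems, of "Suc n"] Suc.prems show ?case by blast
  }
qed

lemma first_passage_nonneg: "i \<in> S \<Longrightarrow> l \<in> S \<Longrightarrow> 0 \<le> first_passage S P n l i"
  using first_passage_Suc_Suc[of i l "n - 1"] by (cases n) auto

text \<open>First passage probabilities condition on the first step, taboo probabilities on the last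
  one. The two are matched by transferring the steps of the path one at a time from one factor to
  the other.\<close>

lemma first_passage_taboo_prob:
  assumes i: "i \<in> S"
  shows "ennreal (first_passage S P (Suc n) i i)
       = (\<integral>\<^sup>+l. taboo_prob i n l * ennreal (P l i) \<partial>count_space S)"
proof -
  let ?F = "\<lambda>n l. ennreal (first_passage S P n l i)"
  have step: "(\<integral>\<^sup>+l. taboo_prob i m l * ?F (Suc (Suc n)) l \<partial>count_space S)
      = (\<integral>\<^sup>+l. taboo_prob i (Suc m) l * ?F (Suc n) l \<partial>count_space S)" for m n
  proof -
    have "(\<integral>\<^sup>+l. taboo_prob i m l * ?F (Suc (Suc n)) l \<partial>count_space S)
      = (\<integral>\<^sup>+l. \<integral>\<^sup>+k. taboo_prob i m l * (if k = i then 0 else ennreal (P l k) * ?F (Suc n) k)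
           \<partial>count_space S \<partial>count_space S)"
      using first_passage_Suc_Suc[OF i] by (intro nn_integral_cong) (simp add: nn_integral_cmult)
    also have "\<dots> = (\<integral>\<^sup>+k. \<integral>\<^sup>+l. taboo_prob i m l * (if k = i then 0 else ennreal (P l k) * ?F (Suc n) k)
           \<partial>count_space S \<partial>count_space S)"
      by (rule nn_integral_count_space_swap) simp
    also have "\<dots> = (\<integral>\<^sup>+k. taboo_prob i (Suc m) k * ?F (Suc n) k \<partial>count_space S)"
      by (intro nn_integral_cong) (simp add: nn_integral_multc flip: mult.assoc)
    finally show ?thesis .
  qed
  have "(\<integral>\<^sup>+l. taboo_prob i m l * ?F (Suc n) l \<partial>count_space S)
      = (\<integral>\<^sup>+l. taboo_prob i (m + n) l * ennreal (P l i) \<partial>count_space S)" for m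
  proof (induction n arbitrary: m)
    case (Suc n)
    show ?case unfolding step Suc.IH by simp
  qed simp
  \<comment> \<open>At \<open>m = 0\<close> the taboo distribution is the point mass at
    \<open>i\<close>, so the left-hand side is the first return probability itself.\<close>
  from this[of 0] show ?thesis
    using nn_integral_count_space_single[OF i, of "?F (Suc n)"] by simp
qed

end

text \<open>Here \<open>f\<close> is the distribution of a return time and \<open>s n\<close> the probability that it exceeds \<open>n\<close>;
  the bound is the expected return time, by Abel summation.\<close>
lemma sum_tails_le:
  fixes s f :: "nat \<Rightarrow> real"
  assumes s0: "s 0 = 1" and step: "\<And>n. s n = s (Suc n) + f (Suc n)"
    and f: "f 0 = 0" "\<And>n. 0 \<le> f n" "f sums 1" "summable (\<lambda>n. real n * f n)"
  shows "(\<Sum>n<N. s n) \<le> (\<Sum>n. real n * f n)"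
proof -
  have eq: "s N = 1 - (\<Sum>k<Suc N. f k)" for N
  proof (induction N)
    case (Suc N)
    then show ?case using step[of N] by simp
  qed (use s0 f(1) in simp)
  \<comment> \<open>Summation by parts. The boundary term \<open>real N * s N\<close> is then
    absorbed by the part of the expectation series beyond index \<open>N\<close>.\<close>
  have abel: "(\<Sum>n<N. s n) = (\<Sum>k<Suc N. real k * f k) + real N * s N"
  proof (induction N)
    case (Suc N)
    then show ?case using step[of N] by (simp add: algebra_simps)
  qed simp
  have sm: "summable f" "suminf f = 1" using f(3) by (auto simp: sums_iff)
  have tail: "s N = (\<Sum>k. f (k + Suc N))"
    using suminf_minus_initial_segment[OF sm(1), of "Suc N"] sm(2) eq[of N] by simp
  have "real N * s N = (\<Sum>k. real N * f (k + Suc N))"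
    unfolding tail using sm by (subst suminf_mult) (auto simp: summable_iff_shift simp del: add_Suc_right)
  also have "\<dots> \<le> (\<Sum>k. real (k + Suc N) * f (k + Suc N))"
  proof (rule suminf_le)
    show "summable (\<lambda>k. real N * f (k + Suc N))"
      by (intro summable_mult summable_ignore_initial_segment sm)
    show "summable (\<lambda>k. real (k + Suc N) * f (k + Suc N))"
      by (rule summable_ignore_initial_segment[OF f(4)])
  qed (use f(2) in \<open>auto intro!: mult_right_mono\<close>)
  also have "\<dots> = (\<Sum>n. real n * f n) - (\<Sum>k<Suc N. real k * f k)"
    by (rule suminf_minus_initial_segment[OF f(4)])
  finally show ?thesis using abel by simp
qed

context stochastic_matrix begin

text \<open>The vector counts the expected visits to \<open>j\<close> during one excursion from
  \<open>i\<close>. Its total mass is the expected return time, finite by positive recurrence, and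
  return with probability 1 makes it stationary at \<open>i\<close>.\<close>

lemma positive_recurrent_stationary:
  assumes rec: "positive_recurrent S P" and i: "i \<in> S"
  obtains \<gamma> where "stationary \<gamma>" "\<gamma> i = 1" "(\<integral>\<^sup>+j. \<gamma> j \<partial>count_space S) < \<infinity>"
proof -
  let ?a = "taboo_prob i"
  define f where "f n = first_passage S P n i i" for n
  have f_nonneg: "0 \<le> f n" for n by (simp add: f_def first_passage_nonneg i)
  have f: "f sums 1" "summable (\<lambda>n. real n * f n)"
    using rec i by (auto simp: positive_recurrent_def f_def[abs_def])
  define \<gamma> where "\<gamma> j = (\<Sum>n. ?a n j)" for j
  \<comment> \<open>The probability that the chain has not returned to \<open>i\<close> up to time
    \<open>n\<close>, so \<open>s 0 = 1\<close>, and \<open>s\<close> drops by the return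
    probability at each step.\<close>
  define s where "s n = (\<integral>\<^sup>+j. ?a n j \<partial>count_space S)" for n
  have f_a: "(\<integral>\<^sup>+l. ?a n l * ennreal (P l i) \<partial>count_space S) = ennreal (f (Suc n))" for n
    using first_passage_taboo_prob[OF i, of n] by (simp add: f_def)
  have s_0: "s 0 = 1"
    using nn_integral_count_space_single[OF i, of "\<lambda>_. 1"] by (simp add: s_def)
  have s_step: "s n = s (Suc n) + ennreal (f (Suc n))" for n
  proof -
    have "s n = (\<integral>\<^sup>+l. \<integral>\<^sup>+j. ?a n l * ennreal (P l j) \<partial>count_space S \<partial>count_space S)"
      unfolding s_def by (intro nn_integral_cong) (simp add: nn_integral_cmult row_sum)
    also have "\<dots> = (\<integral>\<^sup>+j. \<integral>\<^sup>+l. ?a n l * ennreal (P l j) \<partial>count_space S \<partial>count_space S)"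
      by (rule nn_integral_count_space_swap) simp
    also have "\<dots> = (\<integral>\<^sup>+j. ?a (Suc n) j + (if j = i then 1 else 0) * ennreal (f (Suc n)) \<partial>count_space S)"
      by (intro nn_integral_cong) (simp add: f_a)
    also have "\<dots> = s (Suc n) + ennreal (f (Suc n))"
      by (subst nn_integral_add) (simp_all only: s_def nn_integral_count_space_single[OF i] borel_measurable_count_space)
    finally show ?thesis .
  qed
  have s_le: "s n \<le> 1" for n
  proof (induction n)
    case (Suc n)
    then show ?case using s_step[of n] by (metis le_iff_add order_trans)
  qed (simp add: s_0)
  then have s_fin: "s n < top" for n by (rule le_less_trans) simp
  have enn_s: "ennreal (enn2real (s n)) = s n" for n using s_fin by simp
  have real_step: "enn2real (s n) = enn2real (s (Suc n)) + f (Suc n)" for n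
    by (subst s_step) (simp add: enn2real_plus s_fin f_nonneg)
  have "(\<Sum>n<N. enn2real (s n)) \<le> (\<Sum>n. real n * f n)" for N
    by (rule sum_tails_le[OF _ real_step _ f_nonneg f]) (simp_all add: s_0 f_def)
  then have "(\<Sum>n<N. s n) \<le> ennreal (\<Sum>n. real n * f n)" for N
    by (subst enn_s[symmetric], subst sum_ennreal) (auto intro: ennreal_leI)
  then have "(\<Sum>n. s n) \<le> ennreal (\<Sum>n. real n * f n)"
    by (intro suminf_le_const) auto
  then have total: "(\<integral>\<^sup>+j. \<gamma> j \<partial>count_space S) < \<infinity>"
    unfolding \<gamma>_def s_def
    by (subst nn_integral_suminf) (auto intro: le_less_trans simp: ennreal_less_top)
  have \<gamma>_split: "\<gamma> j = (\<Sum>n. ?a (Suc n) j) + ?a 0 j" for j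
    unfolding \<gamma>_def using suminf_offset[of "\<lambda>n. ?a n j" 1] by simp
  have \<gamma>_i: "\<gamma> i = 1" by (subst \<gamma>_split) simp
  have "stationary \<gamma>"
    unfolding stationary_def
  proof
    fix j assume j: "j \<in> S"
    have "(\<integral>\<^sup>+l. \<gamma> l * ennreal (P l j) \<partial>count_space S)
        = (\<Sum>n. \<integral>\<^sup>+l. ?a n l * ennreal (P l j) \<partial>count_space S)"
      by (simp add: \<gamma>_def flip: nn_integral_suminf)
    \<comment> \<open>One more step shifts the series by one index. For \<open>j\<close> different
      from \<open>i\<close> the lost initial term is 0. For \<open>j = i\<close> the shifted series
      sums the return probabilities, giving 1, which is also the initial term.\<close>
    also have "\<dots> = \<gamma> j"
    proof (cases "j = i")
      case True
      have "(\<lambda>n. f (Suc n)) sums 1" using f(1) by (subst sums_Suc_iff) (simp add: f_def)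
      then have "(\<Sum>n. ennreal (f (Suc n))) = 1"
        by (subst suminf_ennreal_eq[where x=1]) (simp_all add: f_nonneg)
      then show ?thesis using True by (simp add: f_a \<gamma>_i)
    next
      case False
      then show ?thesis by (subst \<gamma>_split) simp
    qed
    finally show "(\<integral>\<^sup>+l. \<gamma> l * ennreal (P l j) \<partial>count_space S) = \<gamma> j" .
  qed
  from that[OF this \<gamma>_i total] show thesis .
qed

end

section \<open>Visit frequencies for a Markov partition\<close>

text \<open>An unbounded interval contains a ray, and hence segments longer than any given finite
  measure.\<close>

lemma nondeg_closed_interval_finite:
  assumes A: "nondeg_closed_interval A" and fin: "emeasure lebesgue A < \<infinity>"
  obtains u v where "u < v" "A = {u..v}"
proof -
  have A': "is_interval A" "closed A" "interior A \<noteq> {}"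
    using A by (auto simp: nondeg_closed_interval_def)
  have [measurable]: "A \<in> sets lebesgue" using A'(2) by auto
  have no_long: "\<exists>n::nat. \<not> {c..c + real n} \<subseteq> A \<and> \<not> {c - real n..c} \<subseteq> A" for c
  proof -
    obtain r where r: "emeasure lebesgue A = ennreal r" "0 \<le> r"
      using fin by (auto simp: less_top_ennreal)
    obtain n :: nat where n: "r < real n" using reals_Archimedean2 by blast
    have "\<not> {a..b} \<subseteq> A" if "b - a = real n" for a b
    proof
      assume "{a..b} \<subseteq> A"
      then have "emeasure lebesgue {a..b} \<le> emeasure lebesgue A" by (rule emeasure_mono) simp
      then show False using n r that by (simp add: ennreal_le_iff)
    qed
    then show ?thesis by (intro exI[of _ n]) simp
  qed
  have no_ray: "\<not> {c<..} \<subseteq> A" "\<not> {..<c} \<subseteq> A" for c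
  proof -
    show "\<not> {c<..} \<subseteq> A"
    proof
      assume "{c<..} \<subseteq> A"
      moreover obtain n :: nat where "\<not> {c + 1..c + 1 + real n} \<subseteq> A" using no_long by blast
      ultimately show False by force
    qed
    show "\<not> {..<c} \<subseteq> A"
    proof
      assume "{..<c} \<subseteq> A"
      moreover obtain n :: nat where "\<not> {c - 1 - real n..c - 1} \<subseteq> A" using no_long by blast
      ultimately show False by force
    qed
  qed
  have "A \<noteq> UNIV \<and> A \<noteq> {..<b} \<and> A \<noteq> {..b} \<and> A \<noteq> {a<..} \<and> A \<noteq> {a..}" for a b
    using no_ray(1)[of a] no_ray(2)[of b] by auto
  then obtain a b where "A = {} \<or> A = {a<..<b} \<or> A = {a<..b} \<or> A = {a..<b} \<or> A = {a..b}"
    using is_real_interval[OF A'(1)] by metis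
  then have "A \<subseteq> {a..b}" by (elim disjE) auto
  then have "bounded A" using bounded_subset[OF bounded_closed_interval] by blast
  then have "compact A" using A'(2) by (simp add: compact_eq_bounded_closed)
  then obtain u v where uv: "A = {u..v}"
    using A'(1) by (metis is_interval_connected_1 connected_compact_interval_1)
  moreover have "u < v"
    using A'(3) uv by (auto simp: interior_atLeastAtMost_real)
  ultimately show thesis using that by blast
qed

lemma AE_lebesgue_neq: "AE x in lebesgue. x \<noteq> (c::real)"
  by (intro AE_completion AE_lborel_singleton)

section \<open>Measure-theoretic bookkeeping for the partition\<close>

locale bounded_markov_partition =
  fixes X :: "real set" and f :: "real \<Rightarrow> real" and \<H> :: "real set set"
    and J :: "nat set" and H :: "nat \<Rightarrow> real set"
  assumes dyn: "dynamical_system X f" and part: "l_markov_partition X f \<H>"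
    and enum: "enumerates J H \<H>"
    and fin: "\<And>i. i \<in> J \<Longrightarrow> emeasure lebesgue (H i) < \<infinity>"
begin

text \<open>As a simp rule, \<open>emeasure_completion\<close> would turn \<open>emeasure lebesgue (H i)\<close> into an \<open>lborel\<close>
  measure of \<open>main_part\<close>.\<close>
declare emeasure_completion [simp del]

abbreviation P :: "nat \<Rightarrow> nat \<Rightarrow> real" where "P \<equiv> transition_matrix f H"

lemma partition_nondeg: "\<forall>A\<in>\<H>. nondeg_closed_interval A"
  using part unfolding l_markov_partition_def by (elim conjE)

lemma partition_disjoint: "\<forall>A\<in>\<H>. \<forall>B\<in>\<H>. A \<noteq> B \<longrightarrow> interior A \<inter> interior B = {}"
  using part unfolding l_markov_partition_def by (elim conjE)

lemma partition_Union: "X = \<Union>\<H>"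
  using part unfolding l_markov_partition_def by (elim conjE)

lemma partition_image: "\<forall>A\<in>\<H>. \<exists>\<A>. \<A> \<noteq> {} \<and> \<A> \<subseteq> \<H> \<and> interior (f ` A) = interior (\<Union>\<A>)"
  using part unfolding l_markov_partition_def by (elim conjE)

lemma partition_affine: "\<forall>A\<in>\<H>. \<exists>a b. \<forall>x\<in>interior A. f x = a * x + b"
  using part unfolding l_markov_partition_def by (elim conjE)

lemma bij_H: "bij_betw H J \<H>" using enum by (simp add: enumerates_def)

lemma H_mem: "i \<in> J \<Longrightarrow> H i \<in> \<H>" using bij_H by (auto simp: bij_betw_def)

lemma X_eq: "X = (\<Union>i\<in>J. H i)"
  using partition_Union bij_H by (simp add: bij_betw_def)

lemma X_sets [measurable]: "X \<in> sets lebesgue" using dyn by (simp add: dynamical_system_def)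

lemma sets_X: "B \<in> sets (lebesgue_on X) \<longleftrightarrow> B \<subseteq> X \<and> B \<in> sets lebesgue"
  by (simp add: sets_restrict_space_iff)

lemma f_measurable: "f \<in> lebesgue_on X \<rightarrow>\<^sub>M lebesgue_on X"
  using dyn by (simp add: dynamical_system_def)

lemma f_in: "x \<in> X \<Longrightarrow> f x \<in> X"
  using measurable_space[OF f_measurable] by simp

lemma preimage_sets: "B \<in> sets lebesgue \<Longrightarrow> f -` B \<inter> X \<in> sets lebesgue"
proof -
  assume B: "B \<in> sets lebesgue"
  then have "B \<inter> X \<in> sets (lebesgue_on X)" by (simp add: sets_X)
  from measurable_sets[OF f_measurable this] have "f -` (B \<inter> X) \<inter> X \<in> sets lebesgue"
    by (simp add: sets_X)
  moreover have "f -` (B \<inter> X) \<inter> X = f -` B \<inter> X" using f_in by auto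
  ultimately show ?thesis by simp
qed

lemma H_Icc:
  assumes "i \<in> J"
  obtains u v where "u < v" "H i = {u..v}"
proof -
  have "nondeg_closed_interval (H i)"
    using partition_nondeg H_mem[OF assms] by simp
  then show thesis using fin[OF assms] that by (metis nondeg_closed_interval_finite)
qed

lemma H_sets [measurable]: "i \<in> J \<Longrightarrow> H i \<in> sets lebesgue"
  by (erule H_Icc) simp

lemma H_preimage_sets: "i \<in> J \<Longrightarrow> B \<in> sets lebesgue \<Longrightarrow> H i \<inter> f -` B \<in> sets lebesgue"
proof -
  assume *: "i \<in> J" "B \<in> sets lebesgue"
  then have "H i \<inter> f -` B = H i \<inter> (f -` B \<inter> X)" using X_eq by auto
  then show ?thesis using * preimage_sets by auto
qed

lemma emeasure_H: "i \<in> J \<Longrightarrow> emeasure lebesgue (H i) = ennreal (measure lebesgue (H i))"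
  using fin[of i] by (intro emeasure_eq_ennreal_measure) auto

lemma measure_H_pos: "i \<in> J \<Longrightarrow> 0 < measure lebesgue (H i)"
  by (erule H_Icc) simp

lemma emeasure_H_pos: "i \<in> J \<Longrightarrow> 0 < emeasure lebesgue (H i)"
  using measure_H_pos[of i] by (simp add: emeasure_H)

lemma AE_H_interior: "i \<in> J \<Longrightarrow> AE x in lebesgue. x \<in> H i \<longrightarrow> x \<in> interior (H i)"
proof -
  assume "i \<in> J"
  then obtain u v where "H i = {u..v}" by (rule H_Icc)
  then have int: "x \<in> H i \<longrightarrow> x \<in> interior (H i)" if "x \<noteq> u" "x \<noteq> v" for x
    using that by auto
  show ?thesis
    using AE_lebesgue_neq[of u] AE_lebesgue_neq[of v] by eventually_elim (rule int)
qed

lemma interior_H_disjoint: "i \<in> J \<Longrightarrow> j \<in> J \<Longrightarrow> i \<noteq> j \<Longrightarrow> interior (H i) \<inter> interior (H j) = {}"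
  using partition_disjoint bij_H H_mem unfolding bij_betw_def by (metis inj_on_def)

text \<open>A point of two elements is an end point of one of them, and there are only countably
  many end points.\<close>

lemma AE_H_unique: "AE x in lebesgue. \<forall>i\<in>J. \<forall>j\<in>J. x \<in> H i \<longrightarrow> x \<in> H j \<longrightarrow> i = j"
proof -
  have "AE x in lebesgue. \<forall>i\<in>J. x \<in> H i \<longrightarrow> x \<in> interior (H i)"
    by (subst AE_ball_countable) (auto simp: AE_H_interior)
  then show ?thesis
  proof eventually_elim
    case (elim x)
    show ?case
    proof (intro ballI impI)
      fix i j assume "i \<in> J" "j \<in> J" "x \<in> H i" "x \<in> H j"
      then show "i = j" using elim interior_H_disjoint[of i j] by blast
    qed
  qed
qed

text \<open>Countable additivity is applied to the interiors, which are disjoint in the strict sense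
  and exhaust the elements up to null sets.\<close>

lemma emeasure_eq_sum_H:
  assumes B: "B \<subseteq> X" "B \<in> sets lebesgue"
  shows "emeasure lebesgue B = (\<integral>\<^sup>+j. emeasure lebesgue (H j \<inter> B) \<partial>count_space J)"
proof -
  have AE_int: "AE x in lebesgue. \<forall>i\<in>J. x \<in> H i \<longrightarrow> x \<in> interior (H i)"
    by (subst AE_ball_countable) (auto simp: AE_H_interior)
  have "emeasure lebesgue B = emeasure lebesgue (\<Union>j\<in>J. interior (H j) \<inter> B)"
  proof (rule emeasure_eq_AE)
    show "AE x in lebesgue. x \<in> B \<longleftrightarrow> x \<in> (\<Union>j\<in>J. interior (H j) \<inter> B)"
      using AE_int by eventually_elim (use B(1) X_eq in blast)
    show "(\<Union>j\<in>J. interior (H j) \<inter> B) \<in> sets lebesgue"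
      using B(2) by (intro sets.countable_UN') auto
  qed (use B in auto)
  also have "\<dots> = (\<integral>\<^sup>+j. emeasure lebesgue (interior (H j) \<inter> B) \<partial>count_space J)"
    using B(2) interior_H_disjoint
    by (intro emeasure_UN_countable) (auto simp: disjoint_family_on_def)
  also have "\<dots> = (\<integral>\<^sup>+j. emeasure lebesgue (H j \<inter> B) \<partial>count_space J)"
  proof (rule nn_integral_cong)
    fix j assume "j \<in> space (count_space J)"
    then have j: "j \<in> J" by simp
    show "emeasure lebesgue (interior (H j) \<inter> B) = emeasure lebesgue (H j \<inter> B)"
    proof (rule emeasure_eq_AE)
      show "AE x in lebesgue. x \<in> interior (H j) \<inter> B \<longleftrightarrow> x \<in> H j \<inter> B"
        using AE_H_interior[OF j] by eventually_elim (use interior_subset in auto)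
    qed (use B j in auto)
  qed
  finally show ?thesis .
qed

text \<open>Two points of the interior determine the slope, so the description by \<open>THE\<close>
  in \<open>slope\<close> is meaningful.\<close>

lemma affine_on_H:
  assumes i: "i \<in> J"
  obtains b where "\<And>x. x \<in> interior (H i) \<Longrightarrow> f x = slope f (H i) * x + b"
proof -
  obtain u v where uv: "u < v" "H i = {u..v}" using H_Icc[OF i] .
  obtain a b where ab: "\<And>x. x \<in> interior (H i) \<Longrightarrow> f x = a * x + b"
    using partition_affine H_mem[OF i] by blast
  have "slope f (H i) = a"
    unfolding slope_def
  proof (rule the_equality)
    show "\<exists>b. \<forall>x\<in>interior (H i). f x = a * x + b" using ab by blast
    fix a' assume "\<exists>b. \<forall>x\<in>interior (H i). f x = a' * x + b"
    then obtain b' where b': "\<And>x. x \<in> interior (H i) \<Longrightarrow> f x = a' * x + b'" by blast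
    obtain w where w: "u < w" "w < v" using uv(1) dense by blast
    obtain z where z: "u < z" "z < w" using w(1) dense by blast
    have "w \<in> interior (H i)" "z \<in> interior (H i)"
      using w z by (auto simp: uv(2) interior_atLeastAtMost_real)
    then have "a * w + b = a' * w + b'" "a * z + b = a' * z + b'" using ab b' by metis+
    then have "(a - a') * (w - z) = 0" by (simp add: algebra_simps)
    then show "a' = a" using z by simp
  qed
  then show thesis using ab that by blast
qed

section \<open>Relative frequencies, and the matrix acting on them\<close>

definition freq :: "nat \<Rightarrow> real set \<Rightarrow> ennreal" where
  "freq i B = emeasure lebesgue (H i \<inter> B) / emeasure lebesgue (H i)"

lemma emeasure_H_freq: "i \<in> J \<Longrightarrow> emeasure lebesgue (H i) * freq i B = emeasure lebesgue (H i \<inter> B)"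
  using emeasure_H_pos[of i] fin[of i] mult_divide_eq_ennreal[of "emeasure lebesgue (H i)" "emeasure lebesgue (H i \<inter> B)"]
  by (simp add: freq_def ennreal_times_divide mult.commute[of "emeasure lebesgue (H i)"])

text \<open>The link between the map and the chain: on relative frequencies, taking preimages is
  multiplication by the transition matrix. The branch on \<open>H i\<close> multiplies Lebesgue
  measure by the absolute value of its slope, and its image is, up to null sets, a union of
  partition elements; the entries of the matrix record exactly this.\<close>

lemma freq_preimage:
  assumes i: "i \<in> J" and B: "B \<in> sets lebesgue"
  shows "freq i (f -` B) = (\<integral>\<^sup>+j. ennreal (P i j) * freq j B \<partial>count_space J)"
proof -
  obtain u v where uv: "u < v" "H i = {u..v}" using H_Icc[OF i] .
  obtain b where b: "\<And>x. x \<in> interior (H i) \<Longrightarrow> f x = slope f (H i) * x + b"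
    using affine_on_H[OF i] by blast
  define s where "s = slope f (H i)"
  \<comment> \<open>The map is affine only on the open interval. Its values at the two end points
    are arbitrary and may add two points to the image.\<close>
  define G where "G = (\<lambda>x. s * x + b) ` {u<..<v}"
  define D where "D = {u<..<v} \<inter> f -` B"
  have f_eq: "f x = s * x + b" if "u < x" "x < v" for x
    using b[of x] that by (simp add: s_def uv(2))
  have G_eq: "G = f ` {u<..<v}" unfolding G_def using f_eq by (intro image_cong) auto
  have image_H: "f ` H i \<subseteq> insert (f u) (insert (f v) G)"
  proof
    fix y assume "y \<in> f ` H i"
    then obtain x where "u \<le> x" "x \<le> v" "y = f x" by (auto simp: uv)
    then show "y \<in> insert (f u) (insert (f v) G)"
      by (cases "x = u \<or> x = v") (auto simp: G_eq)
  qed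
  have G_sub: "G \<subseteq> f ` H i" by (auto simp: G_eq uv)
  obtain \<A> where \<A>: "\<A> \<noteq> {}" "\<A> \<subseteq> \<H>" "interior (f ` H i) = interior (\<Union>\<A>)"
    using partition_image H_mem[OF i] by blast
  \<comment> \<open>A constant branch would have a finite image, while the Markov condition gives
    the image the interior of a non-empty union of non-degenerate intervals.\<close>
  have s: "s \<noteq> 0"
  proof
    assume "s = 0"
    then have "finite G" using finite_subset[of G "{b}"] by (auto simp: G_def)
    then have "finite (f ` H i)" using image_H finite_subset by blast
    then have "interior (\<Union>\<A>) = {}" using \<A>(3) empty_interior_finite by metis
    moreover obtain A where "A \<in> \<A>" using \<A>(1) by blast
    ultimately have "interior A = {}" using interior_mono[of A "\<Union>\<A>"] by auto
    then show False
      using \<open>A \<in> \<A>\<close> \<A>(2) partition_nondeg by (auto simp: nondeg_closed_interval_def)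
  qed
  have "open G"
    using open_affinity[of "{u<..<v}" s b] s by (simp add: G_def add.commute)
  then have G_int: "G \<subseteq> \<Union>\<A>"
    using interior_maximal[OF G_sub] \<A>(3) interior_subset[of "\<Union>\<A>"] by simp
  have G_X: "G \<subseteq> X" using G_int \<A>(2) partition_Union by auto
  have G_sets [measurable]: "G \<in> sets lebesgue" using \<open>open G\<close> by auto
  \<comment> \<open>Up to null sets, \<open>G\<close> either contains \<open>H j\<close> or misses
    it. A generic common point lies in a member of \<open>\<A>\<close>, which must then be
    \<open>H j\<close>, so the interior of \<open>H j\<close> is contained in the image.\<close>
  have emeasure_G: "emeasure lebesgue (H j \<inter> (G \<inter> B))
      = (if interior (H j) \<subseteq> f ` H i then emeasure lebesgue (H j \<inter> B) else 0)" if j: "j \<in> J" for j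
  proof (cases "interior (H j) \<subseteq> f ` H i")
    case True
    have "AE x in lebesgue. x \<in> H j \<inter> (G \<inter> B) \<longleftrightarrow> x \<in> H j \<inter> B"
      using AE_H_interior[OF j] AE_lebesgue_neq[of "f u"] AE_lebesgue_neq[of "f v"]
      by eventually_elim (use True image_H in auto)
    with True show ?thesis using j B G_sets by (auto intro!: emeasure_eq_AE)
  next
    case False
    have "AE x in lebesgue. x \<notin> H j \<inter> (G \<inter> B)"
      using AE_H_unique
    proof eventually_elim
      case (elim x)
      show ?case
      proof
        assume x: "x \<in> H j \<inter> (G \<inter> B)"
        then obtain A where A: "A \<in> \<A>" "x \<in> A" using G_int by auto
        then obtain k where "k \<in> J" "A = H k" using \<A>(2) bij_H by (auto simp: bij_betw_def)
        then have "H j \<in> \<A>" using elim x A j by auto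
        then have "interior (H j) \<subseteq> interior (f ` H i)"
          using \<A>(3) interior_mono[of "H j" "\<Union>\<A>"] by auto
        then show False using False interior_subset by blast
      qed
    qed
    then have "emeasure lebesgue (H j \<inter> (G \<inter> B)) = 0"
      using j B G_sets by (subst (asm) AE_iff_null_sets[symmetric]) auto
    then show ?thesis using False by simp
  qed
  have "(\<lambda>x. s * x + b) ` D = G \<inter> B"
    using f_eq by (auto simp: D_def G_def)
  then have scale: "emeasure lebesgue (G \<inter> B) = ennreal \<bar>s\<bar> * emeasure lebesgue D"
    using emeasure_lebesgue_affine[of s b D] by simp
  have D_sets: "D \<in> sets lebesgue"
  proof -
    have "D = {u<..<v} \<inter> (H i \<inter> f -` B)" by (auto simp: D_def uv)
    then show ?thesis using H_preimage_sets[OF i B] by auto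
  qed
  have D_eq: "emeasure lebesgue (H i \<inter> f -` B) = emeasure lebesgue D"
  proof (rule emeasure_eq_AE)
    show "AE x in lebesgue. x \<in> H i \<inter> f -` B \<longleftrightarrow> x \<in> D"
      using AE_lebesgue_neq[of u] AE_lebesgue_neq[of v] by eventually_elim (auto simp: D_def uv)
  qed (use H_preimage_sets[OF i B] D_sets in auto)
  define len where "len = measure lebesgue (H i)"
  have len: "0 < len" "emeasure lebesgue (H i) = ennreal len"
    using measure_H_pos[OF i] emeasure_H[OF i] by (auto simp: len_def)
  have "ennreal (P i j) * freq j B
      = emeasure lebesgue (H j \<inter> (G \<inter> B)) * ennreal (1 / (len * \<bar>s\<bar>))" if j: "j \<in> J" for j
  proof (cases "interior (H j) \<subseteq> f ` H i")
    case True
    define m where "m = measure lebesgue (H j)"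
    have m: "0 < m" "emeasure lebesgue (H j) = ennreal m"
      using measure_H_pos[OF j] emeasure_H[OF j] by (auto simp: m_def)
    have "emeasure lebesgue (H j \<inter> B) \<le> emeasure lebesgue (H j)"
      using j by (intro emeasure_mono) auto
    then have "emeasure lebesgue (H j \<inter> B) < top" using m(2) by (metis ennreal_less_top le_less_trans)
    then obtain r where r: "emeasure lebesgue (H j \<inter> B) = ennreal r" "0 \<le> r"
      by (auto simp: less_top_ennreal)
    have "P i j = m / (len * \<bar>s\<bar>)"
      using True by (simp add: transition_matrix_def m_def len_def s_def)
    moreover have "freq j B = ennreal (r / m)"
      using r m by (simp add: freq_def divide_ennreal)
    moreover have "emeasure lebesgue (H j \<inter> (G \<inter> B)) = ennreal r"
      using True r by (simp add: emeasure_G[OF j])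
    ultimately show ?thesis
      using m(1) r(2) len(1) s by (simp flip: ennreal_mult)
  next
    case False
    then show ?thesis using emeasure_G[OF j] by (simp add: transition_matrix_def)
  qed
  then have "(\<integral>\<^sup>+j. ennreal (P i j) * freq j B \<partial>count_space J)
      = (\<integral>\<^sup>+j. emeasure lebesgue (H j \<inter> (G \<inter> B)) * ennreal (1 / (len * \<bar>s\<bar>)) \<partial>count_space J)"
    by (intro nn_integral_cong) simp
  also have "\<dots> = emeasure lebesgue (G \<inter> B) * ennreal (1 / (len * \<bar>s\<bar>))"
    using emeasure_eq_sum_H[OF le_infI1[OF G_X], of B] G_sets B by (subst nn_integral_multc) simp_all
  also have "\<dots> = emeasure lebesgue D * (ennreal \<bar>s\<bar> * ennreal (1 / (len * \<bar>s\<bar>)))"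
    unfolding scale by (simp add: mult_ac)
  also have "ennreal \<bar>s\<bar> * ennreal (1 / (len * \<bar>s\<bar>)) = inverse (ennreal len)"
    using s len(1) by (simp add: inverse_ennreal inverse_eq_divide flip: ennreal_mult)
  also have "emeasure lebesgue D * inverse (ennreal len) = freq i (f -` B)"
    by (simp add: freq_def D_eq len(2) divide_ennreal_def)
  finally show ?thesis by simp
qed

lemma freq_UNIV: "i \<in> J \<Longrightarrow> freq i UNIV = 1"
  using emeasure_H_pos[of i] fin[of i] by (simp add: freq_def ennreal_divide_self)

lemma freq_le_1: "i \<in> J \<Longrightarrow> freq i B \<le> 1"
proof -
  assume i: "i \<in> J"
  have "freq i B \<le> freq i UNIV"
    unfolding freq_def using i by (intro divide_right_mono_ennreal emeasure_mono) auto
  then show ?thesis using freq_UNIV[OF i] by simp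
qed

lemma freq_cong_AE:
  assumes "H i \<inter> A \<in> sets lebesgue" "H i \<inter> B \<in> sets lebesgue"
    and "AE x in lebesgue. x \<in> H i \<longrightarrow> (x \<in> A \<longleftrightarrow> x \<in> B)"
  shows "freq i A = freq i B"
proof -
  have "emeasure lebesgue (H i \<inter> A) = emeasure lebesgue (H i \<inter> B)"
    using assms by (intro emeasure_eq_AE) (auto elim: eventually_mono)
  then show ?thesis by (simp add: freq_def)
qed

text \<open>The row sums are \<open>freq_preimage\<close> for the whole line.\<close>

lemma stochastic_matrix_P: "stochastic_matrix J P"
proof
  show "0 \<le> P i j" if "i \<in> J" "j \<in> J" for i j
    by (simp add: transition_matrix_def)
  show "(\<integral>\<^sup>+j. ennreal (P i j) \<partial>count_space J) = 1" if "i \<in> J" for i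
  proof -
    have "(\<integral>\<^sup>+j. ennreal (P i j) \<partial>count_space J) = (\<integral>\<^sup>+j. ennreal (P i j) * freq j UNIV \<partial>count_space J)"
      by (intro nn_integral_cong) (simp add: freq_UNIV)
    also have "\<dots> = freq i (f -` UNIV)"
      using freq_preimage[OF that, of UNIV] by simp
    finally show ?thesis using freq_UNIV[OF that] by simp
  qed
qed simp

section \<open>Cylinders\<close>

lemma H_subset_X: "i \<in> J \<Longrightarrow> H i \<subseteq> X"
  using X_eq by auto

lemma cylinder_iff:
  "is \<noteq> [] \<Longrightarrow> x \<in> cylinder X f H is \<longleftrightarrow> x \<in> X \<and> (\<forall>k<length is. (f ^^ k) x \<in> H (is ! k))"
  unfolding cylinder_def by fastforce

lemma cylinder_single: "i \<in> J \<Longrightarrow> cylinder X f H [i] = H i"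
  using H_subset_X by (auto simp: cylinder_def)

lemma cylinder_Cons:
  assumes "is \<noteq> []" "i \<in> J"
  shows "cylinder X f H (i # is) = H i \<inter> f -` cylinder X f H is"
proof (intro set_eqI iffI)
  fix x assume x: "x \<in> cylinder X f H (i # is)"
  then have x': "x \<in> X" "\<And>k. k < Suc (length is) \<Longrightarrow> (f ^^ k) x \<in> H ((i # is) ! k)"
    by (auto simp: cylinder_iff)
  have "(f ^^ k) (f x) \<in> H (is ! k)" if "k < length is" for k
    using x'(2)[of "Suc k"] that by (simp add: funpow_swap1)
  then show "x \<in> H i \<inter> f -` cylinder X f H is"
    using x'(2)[of 0] f_in[OF x'(1)] assms(1) by (auto simp: cylinder_iff)
next
  fix x assume x: "x \<in> H i \<inter> f -` cylinder X f H is"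
  then have x': "x \<in> H i" "x \<in> X" "\<And>k. k < length is \<Longrightarrow> (f ^^ k) (f x) \<in> H (is ! k)"
    using H_subset_X[OF assms(2)] assms(1) by (auto simp: cylinder_iff)
  have "(f ^^ k) x \<in> H ((i # is) ! k)" if "k < Suc (length is)" for k
    using x'(1) x'(3)[of "k - 1"] that by (cases k) (simp_all add: funpow_swap1)
  then show "x \<in> cylinder X f H (i # is)"
    using x'(2) by (auto simp: cylinder_iff)
qed

lemma cylinder_sets:
  "is \<noteq> [] \<Longrightarrow> set is \<subseteq> J \<Longrightarrow> cylinder X f H is \<in> sets lebesgue"
proof (induction "is")
  case (Cons i "is")
  show ?case
  proof (cases "is = []")
    case True
    then show ?thesis using Cons.prems by (simp add: cylinder_single)
  next
    case False
    then show ?thesis using Cons by (simp add: cylinder_Cons H_preimage_sets)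
  qed
qed simp

lemma cylinder_subset_X: "is \<noteq> [] \<Longrightarrow> cylinder X f H is \<subseteq> X"
  by (auto simp: cylinder_def)

lemma cylinders_sets:
  "finite W \<Longrightarrow> \<forall>is\<in>W. is \<noteq> [] \<and> set is \<subseteq> J \<Longrightarrow> (\<Union>is\<in>W. cylinder X f H is) \<in> sets lebesgue"
  by (intro sets.finite_UN) (auto intro: cylinder_sets)

section \<open>An invariant set with the same relative frequency in all partition elements\<close>

context
  fixes B :: "real set" and c :: ennreal
  assumes B_sets: "B \<in> sets lebesgue"
    and B_inv: "AE x in lebesgue. x \<in> X \<longrightarrow> (f x \<in> B \<longleftrightarrow> x \<in> B)"
    and freq_B: "\<And>i. i \<in> J \<Longrightarrow> freq i B = c"
begin

text \<open>Cylinders from \<open>W\<close> may overlap, so the finite union is treated as a whole,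
  by induction on the maximal word length. Inside \<open>H j\<close> the union is, up to null sets,
  the preimage of a union with shorter words, and invariance of \<open>B\<close> lets the
  intersection with \<open>B\<close> pass through the preimage.\<close>

lemma freq_cylinders:
  assumes "finite W" "\<forall>is\<in>W. is \<noteq> [] \<and> set is \<subseteq> J \<and> length is \<le> n" "j \<in> J"
  shows "freq j ((\<Union>is\<in>W. cylinder X f H is) \<inter> B) = c * freq j (\<Union>is\<in>W. cylinder X f H is)"
  using assms
proof (induction n arbitrary: W j)
  case 0
  then have "W = {}" by auto
  then show ?case by (simp add: freq_def)
next
  case (Suc n)
  define U where "U = (\<Union>is\<in>W. cylinder X f H is)"
  have U_sets: "U \<in> sets lebesgue"
    unfolding U_def using Suc.prems by (intro cylinders_sets) auto
  show ?case
  \<comment> \<open>The word \<open>[j]\<close> covers all of \<open>H j\<close>. It is separated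
    off because removing its letter would leave the empty word.\<close>
  proof (cases "[j] \<in> W")
    case True
    then have "H j \<subseteq> U" using cylinder_single[OF Suc.prems(3)] by (auto simp: U_def)
    then have "H j \<inter> (U \<inter> B) = H j \<inter> B" "H j \<inter> U = H j \<inter> UNIV" by auto
    then have "freq j (U \<inter> B) = freq j B" "freq j U = freq j UNIV" by (simp_all add: freq_def)
    then show ?thesis
      using freq_B freq_UNIV Suc.prems(3) by (simp add: U_def)
  next
    case False
    define W' where "W' = {is. is \<noteq> [] \<and> j # is \<in> W}"
    define U' where "U' = (\<Union>is\<in>W'. cylinder X f H is)"
    have "W' \<subseteq> tl ` W" by (force simp: W'_def image_iff)
    then have fin_W': "finite W'" using Suc.prems(1) finite_subset by blast
    have W': "\<forall>is\<in>W'. is \<noteq> [] \<and> set is \<subseteq> J \<and> length is \<le> n"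
      using Suc.prems(2) by (force simp: W'_def)
    have U'_sets: "U' \<in> sets lebesgue"
      unfolding U'_def using fin_W' W' by (intro cylinders_sets) auto
    have AE_U: "AE x in lebesgue. x \<in> H j \<longrightarrow> (x \<in> U \<longleftrightarrow> f x \<in> U')"
      using AE_H_unique
    proof eventually_elim
      case (elim x)
      show ?case
      proof (intro impI iffI)
        assume x: "x \<in> H j" "x \<in> U"
        then obtain "is" where is_W: "is \<in> W" "x \<in> cylinder X f H is" by (auto simp: U_def)
        then obtain i is' where is_eq: "is = i # is'" "i \<in> J"
          using Suc.prems(2) by (cases "is") auto
        have "x \<in> H i"
          using is_W(2) is_eq by (cases "is' = []") (simp_all add: cylinder_single cylinder_Cons)
        then have "i = j" using elim x(1) is_eq(2) Suc.prems(3) by blast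
        then have "is' \<noteq> []" using False is_W(1) is_eq by auto
        then show "f x \<in> U'"
          using is_W is_eq \<open>i = j\<close> by (auto simp: U'_def W'_def cylinder_Cons)
      next
        assume x: "x \<in> H j" "f x \<in> U'"
        then obtain "is" where "is \<noteq> []" "j # is \<in> W" "f x \<in> cylinder X f H is"
          by (auto simp: U'_def W'_def)
        then have "x \<in> cylinder X f H (j # is)"
          using x(1) Suc.prems(3) by (simp add: cylinder_Cons)
        then show "x \<in> U" using \<open>j # is \<in> W\<close> by (auto simp: U_def)
      qed
    qed
    have AE_UB: "AE x in lebesgue. x \<in> H j \<longrightarrow> (x \<in> U \<inter> B \<longleftrightarrow> f x \<in> U' \<inter> B)"
      using AE_U B_inv by eventually_elim (use H_subset_X[OF Suc.prems(3)] in auto)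
    have "freq j (U \<inter> B) = freq j (f -` (U' \<inter> B))"
      using AE_UB U_sets U'_sets B_sets Suc.prems(3)
      by (intro freq_cong_AE H_preimage_sets) auto
    also have "\<dots> = (\<integral>\<^sup>+k. ennreal (P j k) * freq k (U' \<inter> B) \<partial>count_space J)"
      using U'_sets B_sets Suc.prems(3) by (intro freq_preimage) auto
    also have "\<dots> = (\<integral>\<^sup>+k. c * (ennreal (P j k) * freq k U') \<partial>count_space J)"
      using Suc.IH[OF fin_W' W'] by (intro nn_integral_cong) (simp add: U'_def mult_ac)
    also have "\<dots> = c * freq j (f -` U')"
      using freq_preimage[OF Suc.prems(3) U'_sets] by (simp add: nn_integral_cmult)
    also have "freq j (f -` U') = freq j U"
      using AE_U U_sets U'_sets Suc.prems(3)
      by (intro freq_cong_AE[symmetric] H_preimage_sets) auto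
    finally show ?thesis by (simp add: U_def)
  qed
qed

text \<open>The bound on the word lengths is their maximum over the finite set \<open>W\<close>; the
  frequencies are then summed over the partition.\<close>

lemma emeasure_cylinders:
  assumes "finite W" "\<forall>is\<in>W. is \<noteq> [] \<and> set is \<subseteq> J"
  defines "U \<equiv> (\<Union>is\<in>W. cylinder X f H is)"
  shows "emeasure lebesgue (U \<inter> B) = c * emeasure lebesgue U"
proof -
  have U: "U \<subseteq> X" "U \<in> sets lebesgue"
    unfolding U_def using assms(1,2) cylinder_subset_X by (blast, intro cylinders_sets)
  have "\<forall>is\<in>W. is \<noteq> [] \<and> set is \<subseteq> J \<and> length is \<le> Max (length ` W)"
    using assms(1,2) by auto
  then have "freq j (U \<inter> B) = c * freq j U" if "j \<in> J" for j
    unfolding U_def using assms(1) that by (intro freq_cylinders)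
  then have "emeasure lebesgue (H j \<inter> (U \<inter> B)) = c * emeasure lebesgue (H j \<inter> U)" if "j \<in> J" for j
    using emeasure_H_freq[OF that, symmetric] that by (simp add: mult_ac)
  then have "(\<integral>\<^sup>+j. emeasure lebesgue (H j \<inter> (U \<inter> B)) \<partial>count_space J)
      = (\<integral>\<^sup>+j. c * emeasure lebesgue (H j \<inter> U) \<partial>count_space J)"
    by (intro nn_integral_cong) simp
  then show ?thesis
    using U B_sets emeasure_eq_sum_H[of U] emeasure_eq_sum_H[of "U \<inter> B"]
    by (simp add: nn_integral_cmult le_infI1)
qed

text \<open>Expansivity approximates the interval by finite unions of cylinders, for which the
  proportion \<open>c\<close> is already known.\<close>

lemma emeasure_interval:
  assumes exp: "expansive X f J H" and c: "c \<le> 1"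
    and I: "is_interval I" "bounded I" "I \<subseteq> X"
  shows "emeasure lebesgue (I \<inter> B) = c * emeasure lebesgue I"
proof -
  have I_sets: "I \<in> sets lebesgue"
    using real_interval_borel_measurable[OF I(1)] by simp
  have approx: "emeasure lebesgue (I \<inter> B) \<le> c * emeasure lebesgue I + ennreal \<epsilon> \<and>
      c * emeasure lebesgue I \<le> emeasure lebesgue (I \<inter> B) + ennreal \<epsilon>" if "0 < \<epsilon>" for \<epsilon>
  proof -
    \<comment> \<open>The approximation error \<open>d\<close> enters twice, once for the
      intersection with \<open>B\<close> and once multiplied by \<open>c\<close>, which is at most
      1.\<close>
    have "0 < \<epsilon> / 2" using that by simp
    then obtain W where W: "finite W" "\<forall>is\<in>W. is \<noteq> [] \<and> set is \<subseteq> J"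
      "emeasure lebesgue (sym_diff I (\<Union>is\<in>W. cylinder X f H is)) < ennreal (\<epsilon> / 2)"
      using exp[unfolded expansive_def, rule_format, OF \<open>0 < \<epsilon> / 2\<close> conjI[OF I(1) conjI[OF I(2,3)]]]
    by auto
    define U where "U = (\<Union>is\<in>W. cylinder X f H is)"
    define d where "d = emeasure lebesgue (sym_diff I U)"
    have U_sets: "U \<in> sets lebesgue" unfolding U_def using W by (intro cylinders_sets)
    have sum: "ennreal (\<epsilon> / 2) + ennreal (\<epsilon> / 2) = ennreal \<epsilon>"
      using that by (simp flip: ennreal_plus)
    have cd: "c * d \<le> ennreal (\<epsilon> / 2)" "d \<le> ennreal (\<epsilon> / 2)"
      using W(3) mult_right_mono[OF c, of d] by (auto simp: d_def U_def intro: order_trans)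
    have UB: "emeasure lebesgue (U \<inter> B) = c * emeasure lebesgue U"
      unfolding U_def by (rule emeasure_cylinders[OF W(1,2)])
    have le: "emeasure lebesgue A \<le> emeasure lebesgue A' + d"
      if "A \<subseteq> A' \<union> sym_diff I U" "A' \<in> sets lebesgue" for A A'
    proof -
      have "emeasure lebesgue A \<le> emeasure lebesgue (A' \<union> sym_diff I U)"
        using that I_sets U_sets by (intro emeasure_mono) auto
      also have "\<dots> \<le> emeasure lebesgue A' + d"
        unfolding d_def using that I_sets U_sets by (intro emeasure_subadditive) auto
      finally show ?thesis .
    qed
    have "emeasure lebesgue (I \<inter> B) \<le> emeasure lebesgue (U \<inter> B) + d"
      using U_sets B_sets by (intro le) auto
    also have "\<dots> \<le> c * (emeasure lebesgue I + d) + d"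
      unfolding UB using I_sets by (intro add_right_mono mult_left_mono le) auto
    also have "\<dots> = c * emeasure lebesgue I + (c * d + d)" by (simp add: distrib_left add_ac)
    also have "\<dots> \<le> c * emeasure lebesgue I + ennreal \<epsilon>"
      unfolding sum[symmetric] by (intro add_left_mono add_mono cd)
    finally have 1: "emeasure lebesgue (I \<inter> B) \<le> c * emeasure lebesgue I + ennreal \<epsilon>" .
    have "c * emeasure lebesgue I \<le> c * (emeasure lebesgue U + d)"
      using U_sets by (intro mult_left_mono le) auto
    also have "\<dots> = emeasure lebesgue (U \<inter> B) + c * d" by (simp add: UB distrib_left)
    also have "\<dots> \<le> (emeasure lebesgue (I \<inter> B) + d) + c * d"
      using I_sets B_sets by (intro add_right_mono le) auto
    also have "\<dots> \<le> emeasure lebesgue (I \<inter> B) + ennreal \<epsilon>"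
      unfolding sum[symmetric] add.assoc by (intro add_left_mono add_mono cd)
    finally show ?thesis using 1 by simp
  qed
  show ?thesis
  proof (rule antisym)
    show "emeasure lebesgue (I \<inter> B) \<le> c * emeasure lebesgue I"
      by (rule ennreal_le_epsilon) (rule approx[THEN conjunct1])
    show "c * emeasure lebesgue I \<le> emeasure lebesgue (I \<inter> B)"
      by (rule ennreal_le_epsilon) (rule approx[THEN conjunct2])
  qed
qed

text \<open>Lebesgue measure on \<open>H i \<inter> B\<close> and \<open>c\<close> times Lebesgue
  measure on \<open>H i\<close> agree on intervals, hence on Borel sets. Testing them on
  \<open>B\<close> itself gives \<open>c = c * c\<close> after division by the measure of
  \<open>H i\<close>.\<close>

lemma freq_0_or_1:
  assumes exp: "expansive X f J H" and i: "i \<in> J"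
  shows "c = 0 \<or> c = 1"
proof -
  have c: "c \<le> 1" using freq_le_1[OF i, of B] freq_B[OF i] by simp
  obtain u v where uv: "u < v" "H i = {u..v}" using H_Icc[OF i] .
  \<comment> \<open>Intervals determine a measure only on Borel sets, so \<open>B\<close> is
    replaced by a Borel subset differing from it by a null set.\<close>
  obtain C N where CN: "fsigma C" "N \<in> null_sets lebesgue" "C \<union> N = B"
    using lebesgue_set_almost_fsigma[OF B_sets] by metis
  have C_sets [measurable]: "C \<in> sets borel" using CN(1) by (cases rule: fsigma.cases) auto
  have H_borel [measurable]: "H i \<in> sets borel" by (simp add: uv)
  have leb: "emeasure lborel S = emeasure lebesgue S" if "S \<in> sets borel" for S :: "real set"
    using that by (simp add: emeasure_completion)
  have CB: "emeasure lebesgue (S \<inter> C) = emeasure lebesgue (S \<inter> B)" if "S \<in> sets borel" for S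
  proof (rule emeasure_eq_AE)
    show "AE x in lebesgue. x \<in> S \<inter> C \<longleftrightarrow> x \<in> S \<inter> B"
      using AE_not_in[OF CN(2)] by eventually_elim (use CN(3) in auto)
  qed (use that B_sets C_sets in auto)
  define M1 where "M1 = density lborel (\<lambda>x. indicator (H i \<inter> C) x)"
  define M2 where "M2 = density lborel (\<lambda>x. c * indicator (H i) x)"
  have M1: "emeasure M1 S = emeasure lebesgue (S \<inter> H i \<inter> B)" if [measurable]: "S \<in> sets borel" for S
  proof -
    have "emeasure M1 S = (\<integral>\<^sup>+x. indicator (H i \<inter> C) x * indicator S x \<partial>lborel)"
      unfolding M1_def by (rule emeasure_density) auto
    also have "\<dots> = (\<integral>\<^sup>+x. indicator (S \<inter> H i \<inter> C) x \<partial>lborel)"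
      by (rule nn_integral_cong) (simp split: split_indicator)
    finally have "emeasure M1 S = (\<integral>\<^sup>+x. indicator (S \<inter> H i \<inter> C) x \<partial>lborel)" .
    then show ?thesis using CB[of "S \<inter> H i"] by (simp add: leb)
  qed
  have M2: "emeasure M2 S = c * emeasure lebesgue (S \<inter> H i)" if [measurable]: "S \<in> sets borel" for S
  proof -
    have "emeasure M2 S = (\<integral>\<^sup>+x. c * indicator (H i) x * indicator S x \<partial>lborel)"
      unfolding M2_def by (rule emeasure_density) auto
    also have "\<dots> = (\<integral>\<^sup>+x. c * indicator (S \<inter> H i) x \<partial>lborel)"
      by (rule nn_integral_cong) (simp split: split_indicator)
    finally have "emeasure M2 S = (\<integral>\<^sup>+x. c * indicator (S \<inter> H i) x \<partial>lborel)" .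
    then show ?thesis by (simp add: nn_integral_cmult leb)
  qed
  \<comment> \<open>A ray meets \<open>H i\<close> in a bounded subinterval of \<open>X\<close>,
    where \<open>emeasure_interval\<close> applies; finite values on rays determine the
    measure.\<close>
  have "M1 = M2"
  proof (rule measure_eqI_lessThan)
    fix x :: real
    have "emeasure M1 {x<..} \<le> emeasure lebesgue (H i)"
      unfolding M1[OF borel_open[OF open_greaterThan]] using i by (intro emeasure_mono) auto
    then show "emeasure M1 {x<..} < \<infinity>" using fin[OF i] by (rule le_less_trans)
    have "is_interval ({x<..} \<inter> H i)"
      by (auto simp: uv(2) is_interval_1)
    moreover have "bounded ({x<..} \<inter> H i)"
      unfolding uv(2) by (rule bounded_subset[OF bounded_closed_interval[of u v]]) auto
    moreover have "{x<..} \<inter> H i \<subseteq> X" using H_subset_X[OF i] by auto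
    ultimately have "emeasure lebesgue ({x<..} \<inter> H i \<inter> B) = c * emeasure lebesgue ({x<..} \<inter> H i)"
      by (rule emeasure_interval[OF exp c])
    then show "emeasure M1 {x<..} = emeasure M2 {x<..}" by (simp add: M1 M2)
  qed (simp_all add: M1_def M2_def)
  then have "emeasure lebesgue (C \<inter> H i \<inter> B) = c * emeasure lebesgue (C \<inter> H i)"
    using M1[OF C_sets] M2[OF C_sets] by simp
  moreover have "C \<inter> H i \<inter> B = H i \<inter> C" "C \<inter> H i = H i \<inter> C" using CN(3) by auto
  moreover have "emeasure lebesgue (H i \<inter> C) = c * emeasure lebesgue (H i)"
    using CB[OF H_borel] emeasure_H_freq[OF i, of B] freq_B[OF i] by (simp add: mult.commute)
  ultimately have "c * emeasure lebesgue (H i) * 1 = c * emeasure lebesgue (H i) * c"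
    by (simp add: mult_ac)
  moreover have "c * emeasure lebesgue (H i) < top"
    using fin[OF i] c by (auto intro!: ennreal_mult_less_top[THEN iffD2] elim: le_less_trans)
  ultimately show ?thesis
    using emeasure_H_pos[OF i] by (subst (asm) ennreal_mult_cancel_left) auto
qed

end

text \<open>Ergodicity. By invariance, the frequencies of \<open>B\<close> form a harmonic function.
  The maximum principle, used from each of two states to the other, makes it constant, and the
  constant is 0 or 1.\<close>

lemma invariant_set_null_or_full:
  assumes exp: "expansive X f J H"
    and irr: "irreducible_chain J P" and rec: "positive_recurrent J P"
    and B: "B \<in> sets lebesgue" "AE x in lebesgue. x \<in> X \<longrightarrow> (f x \<in> B \<longleftrightarrow> x \<in> B)"
  shows "(AE x in lebesgue. x \<in> X \<longrightarrow> x \<notin> B) \<or> (AE x in lebesgue. x \<in> X \<longrightarrow> x \<in> B)"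
proof (cases "J = {}")
  case True
  then show ?thesis using X_eq by simp
next
  case False
  then obtain i where i: "i \<in> J" by auto
  interpret stochastic_matrix J P by (rule stochastic_matrix_P)
  obtain \<gamma> where \<gamma>: "stationary \<gamma>" "\<gamma> i = 1" "(\<integral>\<^sup>+j. \<gamma> j \<partial>count_space J) < \<infinity>"
    using positive_recurrent_stationary[OF rec i] .
  have \<gamma>_pos: "0 < \<gamma> j" if "j \<in> J" for j
    using stationary_pos[OF irr \<gamma>(1) i _ that] \<gamma>(2) by simp
  have harm: "(\<integral>\<^sup>+k. ennreal (P j k) * freq k B \<partial>count_space J) = freq j B" if j: "j \<in> J" for j
  proof -
    have "freq j (f -` B) = freq j B"
    proof (rule freq_cong_AE)
      show "AE x in lebesgue. x \<in> H j \<longrightarrow> (x \<in> f -` B \<longleftrightarrow> x \<in> B)"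
        using B(2) by eventually_elim (use H_subset_X[OF j] in auto)
    qed (use j B H_preimage_sets in auto)
    then show ?thesis using freq_preimage[OF j B(1)] by simp
  qed
  define c where "c = freq i B"
  have freq_fin: "freq j B < \<infinity>" if "j \<in> J" for j
    using freq_le_1[OF that, of B] by (rule le_less_trans) simp
  have freq_c: "freq j B = c" if j: "j \<in> J" for j
    unfolding c_def
    using harmonic_le[OF irr \<gamma>(1) \<gamma>_pos \<gamma>(3) harm i freq_fin[OF i] j]
      harmonic_le[OF irr \<gamma>(1) \<gamma>_pos \<gamma>(3) harm j freq_fin[OF j] i] by (rule antisym[rotated])
  have "c = 0 \<or> c = 1" by (rule freq_0_or_1[OF B freq_c exp i])
  then show ?thesis
  proof
    assume "c = 0"
    have "AE x in lebesgue. \<forall>j\<in>J. x \<notin> H j \<inter> B"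
    proof (subst AE_ball_countable)
      show "\<forall>j\<in>J. AE x in lebesgue. x \<notin> H j \<inter> B"
      proof
        fix j assume j: "j \<in> J"
        have "emeasure lebesgue (H j \<inter> B) = 0"
          using emeasure_H_freq[OF j, of B] freq_c[OF j] \<open>c = 0\<close> by simp
        then show "AE x in lebesgue. x \<notin> H j \<inter> B"
          using j B(1) by (subst AE_iff_null_sets[symmetric]) auto
      qed
    qed simp
    then have "AE x in lebesgue. x \<in> X \<longrightarrow> x \<notin> B"
      by eventually_elim (use X_eq in auto)
    then show ?thesis ..
  next
    assume "c = 1"
    have "AE x in lebesgue. \<forall>j\<in>J. x \<notin> H j - B"
    proof (subst AE_ball_countable)
      show "\<forall>j\<in>J. AE x in lebesgue. x \<notin> H j - B"
      proof
        fix j assume j: "j \<in> J"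
        have eq: "emeasure lebesgue (H j \<inter> B) = emeasure lebesgue (H j)"
          using emeasure_H_freq[OF j, of B] freq_c[OF j] \<open>c = 1\<close> by simp
        have "emeasure lebesgue (H j - H j \<inter> B) = emeasure lebesgue (H j) - emeasure lebesgue (H j \<inter> B)"
          using j B(1) fin[OF j] eq by (intro emeasure_Diff) auto
        then have "emeasure lebesgue (H j - B) = 0"
          using eq fin[OF j] by (simp add: Diff_Int_distrib Diff_Int)
        then show "AE x in lebesgue. x \<notin> H j - B"
          using j B(1) by (subst AE_iff_null_sets[symmetric]) auto
      qed
    qed simp
    then have "AE x in lebesgue. x \<in> X \<longrightarrow> x \<in> B"
      by eventually_elim (use X_eq in auto)
    then show ?thesis ..
  qed
qed

end

section \<open>The dichotomy for invariant densities\<close>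

context bounded_markov_partition
begin

text \<open>Summing over all elements avoids choosing one at a shared end point; contributions add
  up there, but only on a null set.\<close>

definition chain_density :: "(nat \<Rightarrow> ennreal) \<Rightarrow> real \<Rightarrow> ennreal" where
  "chain_density \<gamma> x = (\<integral>\<^sup>+j. \<gamma> j / emeasure lebesgue (H j) * indicator (H j) x \<partial>count_space J)"

lemma chain_density_measurable: "chain_density \<gamma> \<in> borel_measurable (lebesgue_on X)"
proof -
  \<comment> \<open>Since \<open>J\<close> consists of natural numbers, the integral over
    \<open>J\<close> can be rewritten as a series of measurable functions, with an indicator for the
    missing indices.\<close>
  have "(\<lambda>x. \<Sum>j. \<gamma> j / emeasure lebesgue (H j) * indicator (H j) x * indicator J j)
      \<in> borel_measurable (lebesgue_on X)"
  proof (intro borel_measurable_suminf_order)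
    fix j
    show "(\<lambda>x. \<gamma> j / emeasure lebesgue (H j) * indicator (H j) x * indicator J j)
        \<in> borel_measurable (lebesgue_on X)"
    proof (cases "j \<in> J")
      case True
      then have "H j \<in> sets (lebesgue_on X)" using H_subset_X by (simp add: sets_X)
      then show ?thesis by measurable
    qed simp
  qed
  moreover have "chain_density \<gamma>
      = (\<lambda>x. \<Sum>j. \<gamma> j / emeasure lebesgue (H j) * indicator (H j) x * indicator J j)"
    by (simp add: fun_eq_iff chain_density_def nn_integral_count_space_indicator[of J] nn_integral_count_space_nat)
  ultimately show ?thesis by simp
qed

text \<open>Expresses the mass through relative frequencies, so that invariance under the map
  reduces to stationarity of \<open>\<gamma>\<close> by way of \<open>freq_preimage\<close>.\<close>

lemma emeasure_chain_density:
  assumes A: "A \<in> sets (lebesgue_on X)"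
  shows "emeasure (density (lebesgue_on X) (chain_density \<gamma>)) A
       = (\<integral>\<^sup>+j. \<gamma> j * freq j A \<partial>count_space J)"
proof -
  have A': "A \<subseteq> X" "A \<in> sets lebesgue" using A by (auto simp: sets_X)
  have HA: "H j \<inter> A \<in> sets (lebesgue_on X)" if "j \<in> J" for j
    using that A' by (auto simp: sets_X)
  have "emeasure (density (lebesgue_on X) (chain_density \<gamma>)) A
      = (\<integral>\<^sup>+x. \<integral>\<^sup>+j. \<gamma> j / emeasure lebesgue (H j) * indicator (H j \<inter> A) x \<partial>count_space J \<partial>lebesgue_on X)"
    using A chain_density_measurable[of \<gamma>]
    by (subst emeasure_density)
       (auto simp: chain_density_def indicator_inter_arith mult.assoc simp flip: nn_integral_multc intro!: nn_integral_cong)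
  also have "\<dots> = (\<integral>\<^sup>+j. \<integral>\<^sup>+x. \<gamma> j / emeasure lebesgue (H j) * indicator (H j \<inter> A) x \<partial>lebesgue_on X \<partial>count_space J)"
    using HA by (intro nn_integral_count_space_nn_integral) auto
  also have "\<dots> = (\<integral>\<^sup>+j. \<gamma> j * freq j A \<partial>count_space J)"
  proof (rule nn_integral_cong)
    fix j assume "j \<in> space (count_space J)"
    then have j: "j \<in> J" by simp
    have "emeasure (lebesgue_on X) (H j \<inter> A) = emeasure lebesgue (H j \<inter> A)"
      using A'(1) by (intro emeasure_restrict_space) auto
    then show "(\<integral>\<^sup>+x. \<gamma> j / emeasure lebesgue (H j) * indicator (H j \<inter> A) x \<partial>lebesgue_on X)
        = \<gamma> j * freq j A"
      using HA[OF j] by (simp add: nn_integral_cmult freq_def divide_ennreal_def mult_ac)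
  qed
  finally show ?thesis .
qed

lemma invariant_density_chain_density:
  assumes st: "stochastic_matrix.stationary J P \<gamma>"
  shows "invariant_density (lebesgue_on X) f (chain_density \<gamma>)"
  unfolding invariant_density_def
proof safe
  interpret stochastic_matrix J P by (rule stochastic_matrix_P)
  fix A assume A: "A \<in> sets (lebesgue_on X)"
  have pre: "f -` A \<inter> X \<in> sets (lebesgue_on X)"
    using measurable_sets[OF f_measurable A] by simp
  have freq_X: "freq j (f -` A \<inter> X) = freq j (f -` A)" if "j \<in> J" for j
  proof -
    have "H j \<inter> (f -` A \<inter> X) = H j \<inter> f -` A" using H_subset_X[OF that] by auto
    then show ?thesis by (simp add: freq_def)
  qed
  have "emeasure (density (lebesgue_on X) (chain_density \<gamma>)) (f -` A \<inter> X)
      = (\<integral>\<^sup>+j. \<gamma> j * freq j (f -` A) \<partial>count_space J)"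
    unfolding emeasure_chain_density[OF pre] by (intro nn_integral_cong) (simp add: freq_X)
  also have "\<dots> = (\<integral>\<^sup>+j. \<integral>\<^sup>+k. \<gamma> j * (ennreal (P j k) * freq k A) \<partial>count_space J \<partial>count_space J)"
    using A by (intro nn_integral_cong) (simp add: freq_preimage sets_X nn_integral_cmult)
  also have "\<dots> = (\<integral>\<^sup>+k. \<integral>\<^sup>+j. \<gamma> j * ennreal (P j k) * freq k A \<partial>count_space J \<partial>count_space J)"
    by (subst nn_integral_count_space_swap) (simp_all add: mult.assoc)
  also have "\<dots> = (\<integral>\<^sup>+k. \<gamma> k * freq k A \<partial>count_space J)"
    using st by (intro nn_integral_cong) (simp add: nn_integral_multc stationary_def)
  also have "\<dots> = emeasure (density (lebesgue_on X) (chain_density \<gamma>)) A"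
    by (rule emeasure_chain_density[OF A, symmetric])
  finally show "emeasure (density (lebesgue_on X) (chain_density \<gamma>)) (f -` A \<inter> space (lebesgue_on X))
      = emeasure (density (lebesgue_on X) (chain_density \<gamma>)) A" by simp
qed (rule chain_density_measurable)

lemma chain_density_pos:
  assumes "\<And>j. j \<in> J \<Longrightarrow> 0 < \<gamma> j" "x \<in> X"
  shows "0 < chain_density \<gamma> x"
proof -
  obtain j where j: "j \<in> J" "x \<in> H j" using assms(2) X_eq by auto
  have "0 < \<gamma> j / emeasure lebesgue (H j) * indicator (H j) x"
    using j assms(1)[OF j(1)] fin[OF j(1)] by (simp add: ennreal_zero_less_divide)
  also have "\<dots> \<le> chain_density \<gamma> x"
    unfolding chain_density_def by (rule nn_integral_ge_point[OF j(1)])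
  finally show ?thesis .
qed

lemma nn_integral_chain_density:
  "(\<integral>\<^sup>+x. chain_density \<gamma> x \<partial>lebesgue_on X) = (\<integral>\<^sup>+j. \<gamma> j \<partial>count_space J)"
proof -
  have X: "X \<in> sets (lebesgue_on X)" by (simp add: sets_X)
  have "(\<integral>\<^sup>+x. chain_density \<gamma> x \<partial>lebesgue_on X) = (\<integral>\<^sup>+j. \<gamma> j * freq j X \<partial>count_space J)"
    using emeasure_chain_density[OF X, of \<gamma>] emeasure_density_space[OF chain_density_measurable, of \<gamma>]
    by simp
  also have "\<dots> = (\<integral>\<^sup>+j. \<gamma> j \<partial>count_space J)"
  proof (rule nn_integral_cong)
    fix j assume "j \<in> space (count_space J)"
    then have j: "j \<in> J" by simp
    have "freq j X = freq j UNIV" using H_subset_X[OF j] by (simp add: freq_def Int_absorb2)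
    then show "\<gamma> j * freq j X = \<gamma> j" using freq_UNIV[OF j] by simp
  qed
  finally show ?thesis .
qed

text \<open>The superlevel sets of \<open>\<rho>\<close> over the multiples of an integrable
  positive invariant density are each null or full. One null set bounds \<open>\<rho>\<close> by an
  integrable function; if all are full, \<open>\<rho>\<close> exceeds every multiple.\<close>

lemma invariant_density_finite_or_infinite:
  assumes exp: "expansive X f J H"
    and irr: "irreducible_chain J P" and rec: "positive_recurrent J P"
    and \<rho>: "invariant_density (lebesgue_on X) f \<rho>"
  shows "(\<integral>\<^sup>+x. \<rho> x \<partial>lebesgue_on X) < \<infinity> \<or> (AE x in lebesgue_on X. \<rho> x = \<infinity>)"
proof (cases "J = {}")
  case True
  then have "X = {}" using X_eq by simp
  then show ?thesis by (simp add: AE_restrict_space_iff)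
next
  case False
  then obtain i where i: "i \<in> J" by auto
  interpret stochastic_matrix J P by (rule stochastic_matrix_P)
  obtain \<gamma> where \<gamma>: "stationary \<gamma>" "\<gamma> i = 1" "(\<integral>\<^sup>+j. \<gamma> j \<partial>count_space J) < \<infinity>"
    using positive_recurrent_stationary[OF rec i] .
  have \<gamma>_pos: "0 < \<gamma> j" if "j \<in> J" for j
    using stationary_pos[OF irr \<gamma>(1) i _ that] \<gamma>(2) by simp
  define h where "h = chain_density \<gamma>"
  have h: "invariant_density (lebesgue_on X) f h" "(\<integral>\<^sup>+x. h x \<partial>lebesgue_on X) < \<infinity>"
    "\<And>x. x \<in> X \<Longrightarrow> 0 < h x"
    unfolding h_def using invariant_density_chain_density[OF \<gamma>(1)] \<gamma>(3) chain_density_pos \<gamma>_pos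
    by (auto simp: nn_integral_chain_density)
  have [measurable]: "h \<in> borel_measurable (lebesgue_on X)" "\<rho> \<in> borel_measurable (lebesgue_on X)"
    using h(1) \<rho> by (auto simp: invariant_density_def)
  define B where "B n = {x \<in> X. of_nat n * h x < \<rho> x}" for n :: nat
  have B_sets: "B n \<in> sets lebesgue" for n
  proof -
    have "{x \<in> space (lebesgue_on X). of_nat n * h x < \<rho> x} \<in> sets (lebesgue_on X)" by measurable
    then show ?thesis by (simp add: B_def sets_X)
  qed
  have dichotomy: "(AE x in lebesgue. x \<in> X \<longrightarrow> x \<notin> B n) \<or> (AE x in lebesgue. x \<in> X \<longrightarrow> x \<in> B n)" for n
  proof (rule invariant_set_null_or_full[OF exp irr rec B_sets])
    have "AE x in lebesgue_on X. of_nat n * h (f x) < \<rho> (f x) \<longleftrightarrow> of_nat n * h x < \<rho> x"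
      by (rule AE_superlevel_invariant[OF f_measurable \<rho> h(1,2)]) (simp add: h(3))
    then show "AE x in lebesgue. x \<in> X \<longrightarrow> (f x \<in> B n \<longleftrightarrow> x \<in> B n)"
      by (subst (asm) AE_restrict_space_iff) (auto simp: B_def f_in elim: eventually_mono)
  qed
  show ?thesis
  proof (cases "\<exists>n. AE x in lebesgue. x \<in> X \<longrightarrow> x \<notin> B n")
    case True
    then obtain n where "AE x in lebesgue. x \<in> X \<longrightarrow> x \<notin> B n" by auto
    then have "AE x in lebesgue_on X. \<rho> x \<le> of_nat n * h x"
      by (subst AE_restrict_space_iff) (auto simp: B_def not_less elim: eventually_mono)
    then have "(\<integral>\<^sup>+x. \<rho> x \<partial>lebesgue_on X) \<le> (\<integral>\<^sup>+x. of_nat n * h x \<partial>lebesgue_on X)"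
      by (rule nn_integral_mono_AE)
    also have "\<dots> < \<infinity>"
      using h(2) by (simp add: nn_integral_cmult ennreal_mult_less_top of_nat_less_top)
    finally show ?thesis ..
  next
    case False
    then have "\<forall>n. AE x in lebesgue. x \<in> X \<longrightarrow> x \<in> B n" using dichotomy by blast
    then have "AE x in lebesgue. \<forall>n. x \<in> X \<longrightarrow> x \<in> B n"
      by (rule AE_all_countable[THEN iffD2])
    then have "AE x in lebesgue_on X. \<forall>n. of_nat n * h x < \<rho> x"
      by (subst AE_restrict_space_iff) (auto simp: B_def elim: eventually_mono)
    moreover have "AE x in lebesgue_on X. x \<in> X" using AE_space[of "lebesgue_on X"] by simp
    ultimately have "AE x in lebesgue_on X. \<rho> x = \<infinity>"
    proof eventually_elim
      case (elim x)
      \<comment> \<open>Positivity of \<open>h\<close> at every point makes its multiples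
        unbounded.\<close>
      have "(SUP n. of_nat n * h x) = top"
        using h(3)[OF elim(2)] by (simp add: ennreal_SUP_of_nat_eq_top SUP_mult_right_ennreal[symmetric] ennreal_top_mult)
      moreover have "(SUP n. of_nat n * h x) \<le> \<rho> x"
        using elim(1) by (intro SUP_least) (simp add: less_imp_le)
      ultimately have "top \<le> \<rho> x" by (simp only:)
      then show ?case by (simp add: top_unique)
    qed
    then show ?thesis ..
  qed
qed

end

text \<open>Infinite total mass excludes the integrable case of the dichotomy. Hence
  \<open>\<rho>\<close> is infinite almost everywhere, and a set of positive Lebesgue measure
  receives infinite mass.\<close>

theorem theorem5p7:
  fixes X :: "real set" and f :: "real \<Rightarrow> real"
    and \<H> :: "real set set" and J :: "nat set" and H :: "nat \<Rightarrow> real set"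
    and P :: "nat \<Rightarrow> nat \<Rightarrow> real"
    and \<tau> \<rho> :: "real \<Rightarrow> ennreal" and \<pi> \<mu> :: "real measure"
  assumes "dynamical_system X f"
    and "l_markov_partition X f \<H>"
    and "enumerates J H \<H>"
    and "expansive X f J H"
    and "\<And>i. i \<in> J \<Longrightarrow> emeasure lebesgue (H i) < \<infinity>"
    and "P = transition_matrix f H"
    and "irreducible_chain J P"
    and "aperiodic_chain J P"
    and "positive_recurrent J P"
    and "\<And>i x. i \<in> J \<Longrightarrow> x \<in> interior (H i) \<Longrightarrow>
           \<tau> x = ennreal (lim (\<lambda>k. mat_pow J P k i i) / measure lebesgue (H i))"
    and "has_density X \<pi> \<tau>"
    and "invariant_measure X f \<mu>"
    and "has_density X \<mu> \<rho>"
    and "emeasure \<mu> X = \<infinity>"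
    and "absolutely_continuous \<pi> (lebesgue_on X)"
  shows "\<forall>A \<in> sets (lebesgue_on X). emeasure lebesgue A \<noteq> 0 \<longrightarrow> emeasure \<mu> A = \<infinity>"
proof (intro ballI impI)
  interpret bounded_markov_partition X f \<H> J H
    by unfold_locales (use assms in auto)
  fix A assume A: "A \<in> sets (lebesgue_on X)" "emeasure lebesgue A \<noteq> 0"
  have [measurable]: "\<rho> \<in> borel_measurable (lebesgue_on X)"
    using assms(13) by (simp add: has_density_def)
  have \<mu>_eq: "emeasure \<mu> S = emeasure (density (lebesgue_on X) \<rho>) S" if "S \<in> sets (lebesgue_on X)" for S
    using assms(13) that by (simp add: has_density_def emeasure_density)
  have "invariant_density (lebesgue_on X) f \<rho>"
    unfolding invariant_density_def
  proof safe
    fix S assume S: "S \<in> sets (lebesgue_on X)"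
    have "f -` S \<inter> X \<in> sets (lebesgue_on X)" using measurable_sets[OF f_measurable S] by simp
    then show "emeasure (density (lebesgue_on X) \<rho>) (f -` S \<inter> space (lebesgue_on X))
        = emeasure (density (lebesgue_on X) \<rho>) S"
      using assms(12) S by (simp add: \<mu>_eq[symmetric] invariant_measure_def)
  qed simp
  then have dich: "(\<integral>\<^sup>+x. \<rho> x \<partial>lebesgue_on X) < \<infinity> \<or> (AE x in lebesgue_on X. \<rho> x = \<infinity>)"
    using assms(4,6,7,9) by (intro invariant_density_finite_or_infinite) auto
  have X: "X \<in> sets (lebesgue_on X)" by (simp add: sets_X)
  have "emeasure \<mu> X = (\<integral>\<^sup>+x. \<rho> x \<partial>lebesgue_on X)"
    unfolding \<mu>_eq[OF X] using emeasure_density_space[of \<rho> "lebesgue_on X"] by simp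
  with dich assms(14) have inf: "AE x in lebesgue_on X. \<rho> x = \<infinity>" by simp
  have "emeasure \<mu> A = (\<integral>\<^sup>+x. \<rho> x * indicator A x \<partial>lebesgue_on X)"
    unfolding \<mu>_eq[OF A(1)] using A(1) by (simp add: emeasure_density)
  also have "\<dots> = (\<integral>\<^sup>+x. \<infinity> * indicator A x \<partial>lebesgue_on X)"
    using inf by (intro nn_integral_cong_AE) (auto elim: eventually_mono)
  also have "\<dots> = \<infinity> * emeasure (lebesgue_on X) A"
    using A(1) by (simp add: nn_integral_cmult)
  also have "emeasure (lebesgue_on X) A = emeasure lebesgue A"
    using A(1) by (intro emeasure_restrict_space) (auto simp: sets_X)
  finally show "emeasure \<mu> A = \<infinity>" using A(2) by (simp add: ennreal_top_mult)
qed

end
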